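(* Let $q_1,q_2<1$ with $q_1\ge q^*$ and $q_2>q^*$. Assume that $V_i\in C^1(0,\infty)$ and $$\lim_{y\to0}\frac{V_i'(y)}{y^{q_i-1}}=-1,\qquad i=1,2.$$ Then for every $x>0$, $$\lim_{t\to\infty}A(x,t)=\frac{\theta}{\sigma}\Big[(1-q_1)\,Y^{q_1-1}\,1_{\{q_1=q^*\}}-Y\,h'(Y)\Big]\qquad\text{and}\qquad \lim_{t\to\infty}C(x,t)=-V_2'(Y),$$ where $1_{\{q_1=q^*\}}$ equals $1$ if $q_1=q^*$ and $0$ otherwise, $$h(y)=-\int_0^\infty\frac{e^{\beta\tau}}{2\sqrt{\pi}}\int_{-\infty}^\infty e^{-\frac{\eta^2}{4}-(\alpha-1)a\sqrt\tau\,\eta}\,V_2'(ye^{a\sqrt\tau\,\eta})\,d\eta\,d\tau,\qquad y>0$$ (here $\pi=3.14\ldots$), and $Y$ is the unique solution $y>0$ of the equation $$x=y^{q_1-1}\,1_{\{q_1=q^*\}}+h(y).$$ Furthermore, if $V_2$ is the dual function of a power utility, given by $V_2'(y)=-y^{q_2-1}$ with $q_2<0$, and $q_1,q_2>q^*$, then for every $x>0$ $$\lim_{t\to\infty}A(x,t)=\frac{\theta}{\sigma}(1-q_2)x,\qquad \lim_{t\to\infty}C(x,t)=-\lambda(q_2)\,x.$$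
   Context: Market and problem. Let $r>0$ (riskless rate), $\delta>0$ (discount rate), $\mu>0$, $\sigma>0$ be constants, $\theta=\sigma^{-1}(\mu-r)\neq0$ (Sharpe ratio), and $W$ a standard Brownian motion. Wealth satisfies $dX_s=rX_s\,ds+X_s\pi_s\sigma(\theta\,ds+dW_s)-c_s\,ds$, where $\pi_s$ is the proportion of wealth in the risky asset and $c_s\ge0$ is the consumption rate. The agent maximizes $E\big[\int_0^T e^{-\delta s}U_2(c_s)\,ds+e^{-\delta T}U_1(X_T)\big]$ over $(\pi,c)$. The variable $t$ denotes the time horizon (time remaining to the terminal date), so the distant-horizon limit is $t\to\infty$. Standing assumptions on utilities, $i=1,2$: $U_i$ is continuously differentiable, strictly increasing and strictly concave on $(0,\infty)$, $U_i(0)=0$, $U_i'(0)=\infty$, $U_i'(\infty)=0$, and $U_i(x)\le C_0(1+x^p)$ for $x\ge0$ and some constants $C_0>0$, $0<p<1$. The dual functions are $V_i(y)=\sup_{x\ge0}\{U_i(x)-xy\}$, $y>0$. Constants: $\alpha=\frac12+\frac{r-\delta}{\theta^2}$, $a=\frac{\theta}{\sqrt2}$, $\beta=-a^2\alpha^2-\delta$, and for $q<1$ $$\lambda(q)=\beta+(\alpha-q)^2a^2=\tfrac12\theta^2q(q-1)-rq+\delta(q-1).$$ The threshold $q^*=\alpha-\sqrt{\alpha^2+2\delta/\theta^2}<0$ is the unique root of $\lambda$ in $(-\infty,1)$. Optimal strategies. For $y>0$, $t>0$ (with $\pi$ in the next formula the number $3.14\ldots$) let $$I_i(y,t)=\frac{e^{\beta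 t}}{2\sqrt{\pi}}\int_{-\infty}^\infty e^{-\frac{\eta^2}{4}-(\alpha-1)a\sqrt t\,\eta}\,\big|V_i'(ye^{a\sqrt t\,\eta})\big|\,d\eta,\qquad v_y(y,t)=-I_1(y,t)-\int_0^tI_2(y,\tau)\,d\tau .$$ For $x>0$, $t>0$, let $y=y(x,t)>0$ be the unique solution of $x=-v_y(y,t)$. The optimal amount of money in the risky asset and the optimal consumption rate at wealth $x$ with horizon $t$ are $$A(x,t)=\frac{\theta}{\sigma}\,y\,v_{yy}(y,t),\qquad C(x,t)=-V_2'(y),\qquad y=y(x,t),$$ where $v_{yy}=\partial_y v_y$. *)

theory Defs
  imports "HOL-Analysis.Analysis"
begin

text \<open>
  A utility function is a total function on the reals of which only the restriction to
  \<open>[0,\<infinity>)\<close> matters. The conditions \<open>U'(0) = \<infinity>\<close> and \<open>U'(\<infinity>) = 0\<close> are one-sided limits.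
\<close>

definition strictly_concave_on :: "real set \<Rightarrow> (real \<Rightarrow> real) \<Rightarrow> bool" where
  "strictly_concave_on S f \<longleftrightarrow> convex S \<and>
     (\<forall>x\<in>S. \<forall>y\<in>S. \<forall>u. x \<noteq> y \<longrightarrow> 0 < u \<longrightarrow> u < 1 \<longrightarrow>
        (1 - u) * f x + u * f y < f ((1 - u) * x + u * y))"

definition utility_function :: "(real \<Rightarrow> real) \<Rightarrow> bool" where
  "utility_function U \<longleftrightarrow>
     U C1_differentiable_on {0<..} \<and>
     strict_mono_on {0<..} U \<and>
     strictly_concave_on {0<..} U \<and>
     U 0 = 0 \<and>
     filterlim (deriv U) at_top (at_right 0) \<and>
     (deriv U \<longlongrightarrow> 0) at_top \<and>
     (\<exists>C\<^sub>0>0. \<exists>p. 0 < p \<and> p < 1 \<and> (\<forall>x\<ge>0. U x \<le> C\<^sub>0 * (1 + x powr p)))"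

text \<open>Only used at \<open>y > 0\<close>, where the growth condition makes the supremum finite.\<close>

definition dual_function :: "(real \<Rightarrow> real) \<Rightarrow> real \<Rightarrow> real" where
  "dual_function U y = (SUP x\<in>{0..}. U x - x * y)"

text \<open>
  Throughout, \<open>r\<close> is the riskless rate, \<open>\<delta>\<close> the discount rate, \<open>\<theta>\<close> the Sharpe ratio and
  \<open>\<sigma>\<close> the volatility.
\<close>

definition \<alpha>_coeff :: "real \<Rightarrow> real \<Rightarrow> real \<Rightarrow> real" where
  "\<alpha>_coeff r \<delta> \<theta> = 1 / 2 + (r - \<delta>) / \<theta>\<^sup>2"

definition a_coeff :: "real \<Rightarrow> real" where
  "a_coeff \<theta> = \<theta> / sqrt 2"

definition \<beta>_coeff :: "real \<Rightarrow> real \<Rightarrow> real \<Rightarrow> real" where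
  "\<beta>_coeff r \<delta> \<theta> = - (a_coeff \<theta>)\<^sup>2 * (\<alpha>_coeff r \<delta> \<theta>)\<^sup>2 - \<delta>"

definition lambda_rate :: "real \<Rightarrow> real \<Rightarrow> real \<Rightarrow> real \<Rightarrow> real" where
  "lambda_rate r \<delta> \<theta> q = \<beta>_coeff r \<delta> \<theta> + (\<alpha>_coeff r \<delta> \<theta> - q)\<^sup>2 * (a_coeff \<theta>)\<^sup>2"

lemma lambda_rate_eq:
  assumes "\<theta> \<noteq> 0"
  shows "lambda_rate r \<delta> \<theta> q = \<theta>\<^sup>2 * q * (q - 1) / 2 - r * q + \<delta> * (q - 1)"
  using assms
  by (simp add: lambda_rate_def \<beta>_coeff_def \<alpha>_coeff_def a_coeff_def power_divide field_simps power2_eq_square)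

definition q_star :: "real \<Rightarrow> real \<Rightarrow> real \<Rightarrow> real" where
  "q_star r \<delta> \<theta> = \<alpha>_coeff r \<delta> \<theta> - sqrt ((\<alpha>_coeff r \<delta> \<theta>)\<^sup>2 + 2 * \<delta> / \<theta>\<^sup>2)"

text \<open>The function \<open>I\<^sub>i\<close>, with \<open>V\<close> standing for the dual function \<open>V\<^sub>i\<close>.\<close>

definition heat_integral ::
  "real \<Rightarrow> real \<Rightarrow> real \<Rightarrow> (real \<Rightarrow> real) \<Rightarrow> real \<Rightarrow> real \<Rightarrow> real" where
  "heat_integral r \<delta> \<theta> V y t =
     exp (\<beta>_coeff r \<delta> \<theta> * t) / (2 * sqrt pi) *
     (LINT \<eta>|lborel. exp (- (\<eta>\<^sup>2 / 4) - (\<alpha>_coeff r \<delta> \<theta> - 1) * a_coeff \<theta> * sqrt t * \<eta>) *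
        \<bar>deriv V (y * exp (a_coeff \<theta> * sqrt t * \<eta>))\<bar>)"

definition v_y ::
  "real \<Rightarrow> real \<Rightarrow> real \<Rightarrow> (real \<Rightarrow> real) \<Rightarrow> (real \<Rightarrow> real) \<Rightarrow> real \<Rightarrow> real \<Rightarrow> real" where
  "v_y r \<delta> \<theta> V1 V2 y t =
     - heat_integral r \<delta> \<theta> V1 y t - (LINT \<tau>:{0<..<t}|lborel. heat_integral r \<delta> \<theta> V2 y \<tau>)"

definition v_yy ::
  "real \<Rightarrow> real \<Rightarrow> real \<Rightarrow> (real \<Rightarrow> real) \<Rightarrow> (real \<Rightarrow> real) \<Rightarrow> real \<Rightarrow> real \<Rightarrow> real" where
  "v_yy r \<delta> \<theta> V1 V2 y t = deriv (\<lambda>z. v_y r \<delta> \<theta> V1 V2 z t) y"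

definition dual_point ::
  "real \<Rightarrow> real \<Rightarrow> real \<Rightarrow> (real \<Rightarrow> real) \<Rightarrow> (real \<Rightarrow> real) \<Rightarrow> real \<Rightarrow> real \<Rightarrow> real" where
  "dual_point r \<delta> \<theta> V1 V2 x t = (THE y. y > 0 \<and> x = - v_y r \<delta> \<theta> V1 V2 y t)"

text \<open>Optimal amount of money in the risky asset at wealth \<open>x\<close> with horizon \<open>t\<close>.\<close>

definition risky_amount ::
  "real \<Rightarrow> real \<Rightarrow> real \<Rightarrow> real \<Rightarrow> (real \<Rightarrow> real) \<Rightarrow> (real \<Rightarrow> real) \<Rightarrow> real \<Rightarrow> real \<Rightarrow> real" where
  "risky_amount r \<delta> \<sigma> \<theta> V1 V2 x t =
     (let y = dual_point r \<delta> \<theta> V1 V2 x t in \<theta> / \<sigma> * y * v_yy r \<delta> \<theta> V1 V2 y t)"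

text \<open>Optimal consumption rate at wealth \<open>x\<close> with horizon \<open>t\<close>.\<close>

definition consumption_rate ::
  "real \<Rightarrow> real \<Rightarrow> real \<Rightarrow> (real \<Rightarrow> real) \<Rightarrow> (real \<Rightarrow> real) \<Rightarrow> real \<Rightarrow> real \<Rightarrow> real" where
  "consumption_rate r \<delta> \<theta> V1 V2 x t = - deriv V2 (dual_point r \<delta> \<theta> V1 V2 x t)"

definition h_fun :: "real \<Rightarrow> real \<Rightarrow> real \<Rightarrow> (real \<Rightarrow> real) \<Rightarrow> real \<Rightarrow> real" where
  "h_fun r \<delta> \<theta> V2 y =
     - (LINT \<tau>:{0<..}|lborel.
          exp (\<beta>_coeff r \<delta> \<theta> * \<tau>) / (2 * sqrt pi) *
          (LINT \<eta>|lborel. exp (- (\<eta>\<^sup>2 / 4) - (\<alpha>_coeff r \<delta> \<theta> - 1) * a_coeff \<theta> * sqrt \<tau> * \<eta>) *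
             deriv V2 (y * exp (a_coeff \<theta> * sqrt \<tau> * \<eta>))))"

end

theory Submission
  imports Defs "HOL-Probability.Distributions"
begin

text \<open>
  In the logarithmic variable \<open>s = ln y\<close>, with \<open>g\<^sub>i u = - V\<^sub>i' (exp u)\<close>, the function \<open>- v\<^sub>y\<close> at horizon
  \<open>t\<close> is a discounted heat flow of \<open>g\<^sub>1\<close> plus the time integral over \<open>(0, t)\<close> of the flow of \<open>g\<^sub>2\<close>.
  The flow multiplies \<open>exp (- \<kappa> u)\<close> by \<open>exp (\<lambda> (1 - \<kappa>) t)\<close> and constants by \<open>exp (- r t)\<close>. Since \<open>V\<^sub>i\<close> is
  convex, nonincreasing and nonnegative, \<open>g\<^sub>i\<close> is nonincreasing with limit \<open>0\<close> at infinity, and it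
  differs from \<open>exp (- (1 - q\<^sub>i) u)\<close> by at most \<open>\<epsilon> exp (- (1 - q\<^sub>i) u) + C\<^sub>\<epsilon>\<close>; as \<open>\<lambda> (q\<^sub>2) < 0\<close>, all
  limits follow by domination. Differentiating the Gaussian kernel costs a factor \<open>1 / sqrt t\<close>,
  which is integrable at \<open>0\<close>, so the derivatives in \<open>s\<close> converge as well, along any convergent
  choice of \<open>s\<close>. Finally, the strictly decreasing functions \<open>- v\<^sub>y\<close> converge pointwise to a strictly
  decreasing limit, hence so do their solutions at level \<open>x\<close>.
\<close>

section \<open>Gaussian integrals and differentiation under the integral\<close>

text \<open>Completing the square turns the integrand into a multiple of the normal density with
  mean \<open>c / (2 * p)\<close> and variance \<open>1 / (2 * p)\<close>.\<close>

lemma gaussian_integral: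
  fixes p c :: real
  assumes "p > 0"
  shows integrable_gaussian: "integrable lborel (\<lambda>x. exp (- (p * x\<^sup>2) + c * x))"
    and integral_gaussian: "(LINT x|lborel. exp (- (p * x\<^sup>2) + c * x)) = sqrt (pi / p) * exp (c\<^sup>2 / (4 * p))"
proof -
  have eq: "exp (- (p * x\<^sup>2) + c * x) =
      sqrt (pi / p) * exp (c\<^sup>2 / (4 * p)) * normal_density (c / (2 * p)) (1 / sqrt (2 * p)) x" for x
  proof -
    have s: "2 * pi * (1 / sqrt (2 * p))\<^sup>2 = pi / p" "2 * (1 / sqrt (2 * p))\<^sup>2 = 1 / p"
      using assms by (simp_all add: power_divide)
    have e: "- (p * x\<^sup>2) + c * x = c\<^sup>2 / (4 * p) + (- (x - c / (2 * p))\<^sup>2 / (1 / p))"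
      using assms by (simp add: field_simps power2_eq_square)
    show ?thesis
      unfolding normal_density_def s e exp_add using assms by simp
  qed
  show "integrable lborel (\<lambda>x. exp (- (p * x\<^sup>2) + c * x))"
    unfolding eq by (intro integrable_mult_right integrable_normal_density) (use assms in simp)
  show "(LINT x|lborel. exp (- (p * x\<^sup>2) + c * x)) = sqrt (pi / p) * exp (c\<^sup>2 / (4 * p))"
    unfolding eq using assms by simp
qed

text \<open>The tilt \<open>c\<close> absorbs exponential weights: multiplying by
  \<open>exp (k * x)\<close> replaces \<open>c\<close> by \<open>c + k\<close>, so all integrands
  below stay in one family.\<close>

definition gauss_kernel :: "real \<Rightarrow> real \<Rightarrow> real" where
  "gauss_kernel c x = exp (- (x\<^sup>2 / 4) + c * x)"

lemma gauss_kernel_pos: "0 < gauss_kernel c x"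
  by (simp add: gauss_kernel_def)

lemma gauss_kernel_measurable [measurable]: "gauss_kernel c \<in> borel_measurable borel"
  unfolding gauss_kernel_def by measurable

lemma integrable_gauss_kernel: "integrable lborel (gauss_kernel c)"
  using integrable_gaussian[of "1/4" c] by (simp add: gauss_kernel_def[abs_def] algebra_simps)

lemma integral_gauss_kernel: "integral\<^sup>L lborel (gauss_kernel c) = 2 * sqrt pi * exp (c\<^sup>2)"
  using integral_gaussian[of "1/4" c]
  by (simp add: gauss_kernel_def[abs_def] algebra_simps real_sqrt_mult)

lemma abs_le_exp_exp: "\<bar>x\<bar> \<le> exp x + exp (- x)" for x :: real
  using exp_ge_add_one_self[of x] exp_ge_add_one_self[of "-x"] exp_gt_zero[of x] exp_gt_zero[of "-x"]
  by (simp only: abs_if split: if_splits) linarith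

text \<open>The exponential bound for the absolute value is centred at \<open>2 * c\<close>, the
  mode of the kernel. Tilting by one in either direction then costs only a factor
  \<open>exp 1\<close> in total mass, whatever \<open>c\<close> is.\<close>

lemma gauss_kernel_abs_le:
  "\<bar>x\<bar> * gauss_kernel c x \<le>
     2 * \<bar>c\<bar> * gauss_kernel c x + exp (- (2 * c)) * gauss_kernel (c + 1) x + exp (2 * c) * gauss_kernel (c - 1) x"
proof -
  have "\<bar>x\<bar> \<le> 2 * \<bar>c\<bar> + exp (x - 2 * c) + exp (- (x - 2 * c))"
    using abs_le_exp_exp[of "x - 2 * c"] by linarith
  then have "\<bar>x\<bar> * gauss_kernel c x \<le> (2 * \<bar>c\<bar> + exp (x - 2 * c) + exp (- (x - 2 * c))) * gauss_kernel c x"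
    using gauss_kernel_pos[of c x] by (intro mult_right_mono) auto
  also have "\<dots> = 2 * \<bar>c\<bar> * gauss_kernel c x + exp (- (2 * c)) * gauss_kernel (c + 1) x + exp (2 * c) * gauss_kernel (c - 1) x"
    by (simp add: gauss_kernel_def algebra_simps exp_add[symmetric])
  finally show ?thesis .
qed

lemma integrable_abs_gauss_kernel: "integrable lborel (\<lambda>x. \<bar>x\<bar> * gauss_kernel c x)"
proof (rule Bochner_Integration.integrable_bound)
  show "integrable lborel (\<lambda>x. 2 * \<bar>c\<bar> * gauss_kernel c x + exp (- (2 * c)) * gauss_kernel (c + 1) x +
      exp (2 * c) * gauss_kernel (c - 1) x)"
    by (intro Bochner_Integration.integrable_add integrable_mult_right integrable_gauss_kernel)
  have "norm (\<bar>x\<bar> * gauss_kernel c x) = \<bar>x\<bar> * gauss_kernel c x" for x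
    using gauss_kernel_pos[of c x] by (simp add: abs_mult)
  then show "AE x in lborel. norm (\<bar>x\<bar> * gauss_kernel c x) \<le> norm (2 * \<bar>c\<bar> * gauss_kernel c x +
      exp (- (2 * c)) * gauss_kernel (c + 1) x + exp (2 * c) * gauss_kernel (c - 1) x)"
    by (intro AE_I2) (metis gauss_kernel_abs_le abs_ge_self order_trans real_norm_def)
qed measurable

text \<open>The first absolute moment is at most linear in \<open>\<bar>c\<bar>\<close> relative to
  the total mass. Since \<open>c\<close> will be proportional to \<open>sqrt t\<close>, dividing by
  \<open>sqrt t\<close> leaves a bounded part and a singularity of order
  \<open>1 / sqrt t\<close>.\<close>

lemma integral_abs_gauss_kernel_le:
  "(LINT x|lborel. \<bar>x\<bar> * gauss_kernel c x) \<le> 2 * sqrt pi * exp (c\<^sup>2) * (2 * \<bar>c\<bar> + 2 * exp 1)"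
proof -
  have "(LINT x|lborel. \<bar>x\<bar> * gauss_kernel c x) \<le>
      (LINT x|lborel. 2 * \<bar>c\<bar> * gauss_kernel c x + exp (- (2 * c)) * gauss_kernel (c + 1) x +
        exp (2 * c) * gauss_kernel (c - 1) x)"
    by (intro integral_mono integrable_abs_gauss_kernel gauss_kernel_abs_le
        Bochner_Integration.integrable_add integrable_mult_right integrable_gauss_kernel)
  also have "\<dots> = 2 * \<bar>c\<bar> * (2 * sqrt pi * exp (c\<^sup>2)) + exp (- (2 * c)) * (2 * sqrt pi * exp ((c + 1)\<^sup>2)) +
        exp (2 * c) * (2 * sqrt pi * exp ((c - 1)\<^sup>2))"
    by (simp add: integrable_gauss_kernel integral_gauss_kernel)
  also have "\<dots> = 2 * sqrt pi * exp (c\<^sup>2) * (2 * \<bar>c\<bar> + 2 * exp 1)"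
  proof -
    have "exp (- (2 * c)) * exp ((c + 1)\<^sup>2) = exp (c\<^sup>2) * exp 1" "exp (2 * c) * exp ((c - 1)\<^sup>2) = exp (c\<^sup>2) * exp 1"
      by (simp_all add: exp_add[symmetric] power2_eq_square algebra_simps)
    then show ?thesis by (simp add: algebra_simps)
  qed
  finally show ?thesis .
qed

text \<open>Dominated convergence of difference quotients along sequences; the mean value inequality
  shows that \<open>w\<close> bounds the quotients as well as the derivative.\<close>

lemma has_real_derivative_integral:
  fixes f f' :: "real \<Rightarrow> 'a \<Rightarrow> real"
  assumes d: "d > 0"
    and int: "\<And>s. s \<in> ball s0 d \<Longrightarrow> integrable M (f s)"
    and der: "\<And>s x. s \<in> ball s0 d \<Longrightarrow> x \<in> space M \<Longrightarrow> ((\<lambda>s. f s x) has_real_derivative f' s x) (at s)"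
    and meas: "f' s0 \<in> borel_measurable M"
    and bd: "\<And>s x. s \<in> ball s0 d \<Longrightarrow> x \<in> space M \<Longrightarrow> \<bar>f' s x\<bar> \<le> w x"
    and w: "integrable M w"
  shows "((\<lambda>s. integral\<^sup>L M (f s)) has_real_derivative integral\<^sup>L M (f' s0)) (at s0)"
proof -
  have "((\<lambda>h. (integral\<^sup>L M (f (s0 + h)) - integral\<^sup>L M (f s0)) / h) \<longlongrightarrow> integral\<^sup>L M (f' s0)) (at 0)"
    unfolding tendsto_at_iff_sequentially
  proof (intro allI impI)
    fix X :: "nat \<Rightarrow> real"
    assume X: "\<forall>i. X i \<in> UNIV - {0}" and X0: "X \<longlonglongrightarrow> 0"
    from X0 d have "\<forall>\<^sub>F n in sequentially. \<bar>X n\<bar> < d"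
      by (auto dest!: tendstoD[of _ _ _ d] simp: dist_real_def)
    \<comment> \<open>Dropping the first \<open>N\<close> terms puts every point
      \<open>s0 + Z n\<close> into the ball; \<open>LIMSEQ_offset\<close> restores them at the
      end.\<close>
    then obtain N where N: "\<And>n. n \<ge> N \<Longrightarrow> \<bar>X n\<bar> < d" by (auto simp: eventually_sequentially)
    define Z where "Z n = X (n + N)" for n
    have Z: "Z n \<noteq> 0" "\<bar>Z n\<bar> < d" for n using X N by (auto simp: Z_def)
    have Z0: "Z \<longlonglongrightarrow> 0" unfolding Z_def using X0 by (rule LIMSEQ_ignore_initial_segment)
    have in_ball: "s0 + Z n \<in> ball s0 d" "s0 \<in> ball s0 d" for n using Z d by (auto simp: dist_real_def)
    have lim: "(\<lambda>n. LINT x|M. (f (s0 + Z n) x - f s0 x) / Z n) \<longlonglongrightarrow> integral\<^sup>L M (f' s0)"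
    proof (rule integral_dominated_convergence[where w = w])
      show "AE x in M. (\<lambda>n. (f (s0 + Z n) x - f s0 x) / Z n) \<longlonglongrightarrow> f' s0 x"
      proof (rule AE_I2)
        fix x assume "x \<in> space M"
        from der[OF in_ball(2) this]
        have "((\<lambda>h. (f (s0 + h) x - f s0 x) / h) \<longlongrightarrow> f' s0 x) (at 0)" by (simp add: DERIV_def)
        then show "(\<lambda>n. (f (s0 + Z n) x - f s0 x) / Z n) \<longlonglongrightarrow> f' s0 x"
          unfolding tendsto_at_iff_sequentially using Z(1) Z0 by (auto simp: o_def)
      qed
      show "AE x in M. norm ((f (s0 + Z n) x - f s0 x) / Z n) \<le> w x" for n
      proof (rule AE_I2)
        fix x assume x: "x \<in> space M"
        have "norm (f (s0 + Z n) x - f s0 x) \<le> w x * norm (s0 + Z n - s0)"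
        proof (rule field_differentiable_bound[where S = "ball s0 d" and f' = "\<lambda>s. f' s x"])
          show "((\<lambda>s. f s x) has_field_derivative f' z x) (at z within ball s0 d)" if "z \<in> ball s0 d" for z
            using der[OF that x] by (rule has_field_derivative_at_within)
          show "norm (f' z x) \<le> w x" if "z \<in> ball s0 d" for z using bd[OF that x] by simp
        qed (use in_ball in auto)
        then show "norm ((f (s0 + Z n) x - f s0 x) / Z n) \<le> w x"
          using Z(1)[of n] by (simp add: field_simps)
      qed
      show "(\<lambda>x. (f (s0 + Z n) x - f s0 x) / Z n) \<in> borel_measurable M" for n
        using int[OF in_ball(1)[of n]] int[OF in_ball(2)] by (auto dest!: borel_measurable_integrable)
    qed (use meas w in auto)
    have "(LINT x|M. (f (s0 + Z n) x - f s0 x) / Z n) = (integral\<^sup>L M (f (s0 + Z n)) - integral\<^sup>L M (f s0)) / Z n" for n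
      using int[OF in_ball(1)[of n]] int[OF in_ball(2)] by simp
    from lim[unfolded this] have "(\<lambda>n. (integral\<^sup>L M (f (s0 + Z n)) - integral\<^sup>L M (f s0)) / Z n) \<longlonglongrightarrow> integral\<^sup>L M (f' s0)" .
    then show "((\<lambda>h. (integral\<^sup>L M (f (s0 + h)) - integral\<^sup>L M (f s0)) / h) \<circ> X) \<longlonglongrightarrow> integral\<^sup>L M (f' s0)"
      unfolding Z_def o_def by (rule LIMSEQ_offset)
  qed
  then show ?thesis by (simp add: DERIV_def)
qed

text \<open>Equal integrals would make the nonnegative difference vanish almost everywhere, so the
  nonempty open set \<open>A\<close> would be null.\<close>

lemma integral_strict_mono_on_open:
  fixes X Y :: "real \<Rightarrow> real"
  assumes X: "integrable lborel X" and Y: "integrable lborel Y" and le: "\<And>x. X x \<le> Y x"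
    and A: "open A" "A \<noteq> {}" "\<And>x. x \<in> A \<Longrightarrow> X x < Y x"
  shows "integral\<^sup>L lborel X < integral\<^sup>L lborel Y"
proof -
  have "integral\<^sup>L lborel X \<le> integral\<^sup>L lborel Y"
    using X Y le by (intro integral_mono) auto
  moreover have "integral\<^sup>L lborel X \<noteq> integral\<^sup>L lborel Y"
  proof
    assume "integral\<^sup>L lborel X = integral\<^sup>L lborel Y"
    then have "(LINT x|lborel. Y x - X x) = 0" using X Y by simp
    then have "AE x in lborel. Y x - X x = 0"
      using X Y le by (subst (asm) integral_nonneg_eq_0_iff_AE) auto
    then have "AE x in lborel. x \<notin> A"
      by eventually_elim (use A(3) in force)
    then have "A \<in> null_sets lborel" using A(1) by (subst (asm) AE_iff_null_sets[symmetric]) auto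
    then have "negligible A" by (simp add: negligible_iff_null_sets null_sets_completionI)
    with A(1,2) show False using open_not_negligible by blast
  qed
  ultimately show ?thesis by simp
qed

text \<open>Both summands are Gamma integrands, with exponents \<open>z = 1\<close> and
  \<open>z = 1 / 2\<close>. The result covers the singularity at time zero caused by differentiating
  the kernel.\<close>

lemma integrable_exp_over_sqrt:
  fixes c M N :: real
  assumes "c < 0"
  shows "integrable lborel (\<lambda>t. indicator {0<..} t * ((M + N / sqrt t) * exp (c * t)))"
proof -
  have *: "integrable lborel (\<lambda>t. indicator {0<..} t * (t powr (z - 1) * exp (c * t)))" if "z > 0" for z :: real
  proof -
    \<comment> \<open>The norm of the complex Gamma integrand at a real exponent is the real
      integrand; passing from \<open>lebesgue\<close> to \<open>lborel\<close> uses
      measurability.\<close>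
    have "(\<lambda>t. complex_of_real t powr (complex_of_real z - 1) / of_real (exp (- c * t))) absolutely_integrable_on {0<..}"
      using assms that by (intro absolutely_integrable_Gamma_integral) auto
    then have "integrable lebesgue (\<lambda>t. norm (indicator {0<..} t *\<^sub>R
        (complex_of_real t powr (complex_of_real z - 1) / of_real (exp (- c * t)))))"
      unfolding set_integrable_def by (rule integrable_norm)
    also have "(\<lambda>t. norm (indicator {0<..} t *\<^sub>R
        (complex_of_real t powr (complex_of_real z - 1) / of_real (exp (- c * t))))) =
        (\<lambda>t. indicator {0<..} t * (t powr (z - 1) * exp (c * t)))"
      by (rule ext) (auto simp: indicator_def norm_mult norm_divide norm_powr_real_powr exp_minus field_simps)
    finally show ?thesis by (subst (asm) integrable_completion) auto
  qed
  have "integrable lborel (\<lambda>t. M * (indicator {0<..} t * (t powr (1 - 1) * exp (c * t))) +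
      N * (indicator {0<..} t * (t powr (1 / 2 - 1) * exp (c * t))))"
    by (intro Bochner_Integration.integrable_add integrable_mult_right *) auto
  also have "(\<lambda>t. M * (indicator {0<..} t * (t powr (1 - 1) * exp (c * t))) +
      N * (indicator {0<..} t * (t powr (1 / 2 - 1) * exp (c * t)))) =
      (\<lambda>t. indicator {0<..} t * ((M + N / sqrt t) * exp (c * t)))"
  proof
    fix t :: real
    have "t powr (1 / 2 - 1) = 1 / sqrt t" if "t > 0"
      using that by (simp add: powr_half_sqrt[symmetric] powr_minus_divide[symmetric])
    then show "M * (indicator {0<..} t * (t powr (1 - 1) * exp (c * t))) +
      N * (indicator {0<..} t * (t powr (1 / 2 - 1) * exp (c * t))) = indicator {0<..} t * ((M + N / sqrt t) * exp (c * t))"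
      by (auto simp: indicator_def field_simps)
  qed
  finally show ?thesis .
qed

lemma integral_exp_Ioi:
  fixes c :: real
  assumes "c < 0"
  shows "(LINT t|lborel. indicator {0<..} t * exp (c * t)) = - 1 / c"
proof -
  have "((\<lambda>t. exp (c * t)) has_integral exp (c * 0) / (- c)) {0..}"
    using has_integral_exp_minus_to_infinity[of "- c" 0] assms by simp
  then have "((\<lambda>t. exp (c * t)) has_integral - 1 / c) {0<..}"
    by (subst (asm) has_integral_interior[symmetric]) auto
  moreover have "integrable lborel (\<lambda>t. indicator {0<..} t * exp (c * t))"
    using integrable_exp_over_sqrt[OF assms, of 1 0] by simp
  then have "(LINT t:{0<..}|lborel. exp (c * t)) = integral {0<..} (\<lambda>t. exp (c * t))"
    by (intro set_borel_integral_eq_integral) (auto simp: set_integrable_def)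
  ultimately show ?thesis
    by (simp add: integral_unique set_lebesgue_integral_def)
qed

section \<open>Discounted heat flow\<close>

text \<open>The exponential part controls \<open>u\<close> near minus infinity, that is
  \<open>y\<close> near zero, and the constant part controls large \<open>u\<close>. The two
  coefficients are kept apart because the flow scales the parts at different rates, and either one
  may have to be small.\<close>

definition exp_dominated :: "real \<Rightarrow> real \<Rightarrow> real \<Rightarrow> (real \<Rightarrow> real) \<Rightarrow> bool" where
  "exp_dominated \<kappa> A B g \<longleftrightarrow>
     0 \<le> A \<and> 0 \<le> B \<and> continuous_on UNIV g \<and> (\<forall>u. \<bar>g u\<bar> \<le> A * exp (- (\<kappa> * u)) + B)"

lemma exp_dominated_measurable: "exp_dominated \<kappa> A B g \<Longrightarrow> g \<in> borel_measurable borel"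
  by (auto simp: exp_dominated_def intro: borel_measurable_continuous_onI)

lemma exp_dominated_tendsto:
  assumes "exp_dominated \<kappa> A B g" "f \<longlonglongrightarrow> u"
  shows "(\<lambda>n. g (f n)) \<longlonglongrightarrow> g u"
  using assms continuous_on_tendsto_compose[of UNIV g f u sequentially] by (auto simp: exp_dominated_def)

text \<open>A majorant of the factor \<open>\<eta> / (2 * b) + \<rho>\<close> that appears when the
  kernel is differentiated.\<close>

definition heat_weight :: "real \<Rightarrow> real \<Rightarrow> real \<Rightarrow> real" where
  "heat_weight \<rho> b \<eta> = \<bar>\<eta>\<bar> / (2 * \<bar>b\<bar>) + \<bar>\<rho>\<bar>"

lemma abs_heat_weight: "\<bar>\<eta> / (2 * b) + \<rho>\<bar> \<le> heat_weight \<rho> b \<eta>"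
  unfolding heat_weight_def by (rule order_trans[OF abs_triangle_ineq]) (simp add: abs_mult)

lemma heat_weight_nonneg: "0 \<le> heat_weight \<rho> b \<eta>"
  by (simp add: heat_weight_def)

lemma integrable_heat_weight: "integrable lborel (\<lambda>\<eta>. heat_weight \<rho> b \<eta> * gauss_kernel c \<eta>)"
proof -
  have "integrable lborel (\<lambda>\<eta>. 1 / (2 * \<bar>b\<bar>) * (\<bar>\<eta>\<bar> * gauss_kernel c \<eta>) + \<bar>\<rho>\<bar> * gauss_kernel c \<eta>)"
    by (intro Bochner_Integration.integrable_add integrable_mult_right integrable_abs_gauss_kernel integrable_gauss_kernel)
  then show ?thesis by (simp add: heat_weight_def algebra_simps)
qed

lemma integral_heat_weight_le:
  assumes "b \<noteq> 0"
  shows "(LINT \<eta>|lborel. heat_weight \<rho> b \<eta> * gauss_kernel c \<eta>) \<le>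
    2 * sqrt pi * exp (c\<^sup>2) * (\<bar>c\<bar> / \<bar>b\<bar> + \<bar>\<rho>\<bar> + exp 1 / \<bar>b\<bar>)"
proof -
  have "(LINT \<eta>|lborel. heat_weight \<rho> b \<eta> * gauss_kernel c \<eta>) =
     (LINT \<eta>|lborel. 1 / (2 * \<bar>b\<bar>) * (\<bar>\<eta>\<bar> * gauss_kernel c \<eta>) + \<bar>\<rho>\<bar> * gauss_kernel c \<eta>)"
    by (simp add: heat_weight_def algebra_simps)
  also have "\<dots> = 1 / (2 * \<bar>b\<bar>) * (LINT \<eta>|lborel. \<bar>\<eta>\<bar> * gauss_kernel c \<eta>) + \<bar>\<rho>\<bar> * (2 * sqrt pi * exp (c\<^sup>2))"
    by (subst Bochner_Integration.integral_add)
      (auto intro!: integrable_mult_right integrable_abs_gauss_kernel integrable_gauss_kernel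
        simp: integral_gauss_kernel simp del: integrable_mult_right_iff integrable_mult_left_iff)
  also have "\<dots> \<le> 1 / (2 * \<bar>b\<bar>) * (2 * sqrt pi * exp (c\<^sup>2) * (2 * \<bar>c\<bar> + 2 * exp 1)) + \<bar>\<rho>\<bar> * (2 * sqrt pi * exp (c\<^sup>2))"
    by (intro add_right_mono mult_left_mono integral_abs_gauss_kernel_le) auto
  also have "\<dots> = 2 * sqrt pi * exp (c\<^sup>2) * (\<bar>c\<bar> / \<bar>b\<bar> + \<bar>\<rho>\<bar> + exp 1 / \<bar>b\<bar>)"
    using assms by (simp add: field_simps)
  finally show ?thesis .
qed

text \<open>The factor \<open>exp (- (\<kappa> * b * \<eta>))\<close> of the bound on
  \<open>g\<close> is absorbed by the kernel, whose tilt moves from \<open>- (\<rho> * b)\<close> to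
  \<open>- ((\<kappa> + \<rho>) * b)\<close>.\<close>

lemma heat_integrand_bound:
  assumes "exp_dominated \<kappa> A B g"
  shows "\<bar>gauss_kernel (- (\<rho> * b)) \<eta> * g (s + b * \<eta>)\<bar> \<le>
    A * exp (- (\<kappa> * s)) * gauss_kernel (- ((\<kappa> + \<rho>) * b)) \<eta> + B * gauss_kernel (- (\<rho> * b)) \<eta>"
proof -
  have "\<bar>gauss_kernel (- (\<rho> * b)) \<eta> * g (s + b * \<eta>)\<bar> = gauss_kernel (- (\<rho> * b)) \<eta> * \<bar>g (s + b * \<eta>)\<bar>"
    using gauss_kernel_pos[of "- (\<rho> * b)" \<eta>] by (simp add: abs_mult)
  also have "\<dots> \<le> gauss_kernel (- (\<rho> * b)) \<eta> * (A * exp (- (\<kappa> * (s + b * \<eta>))) + B)"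
    using assms gauss_kernel_pos[of "- (\<rho> * b)" \<eta>] by (intro mult_left_mono) (auto simp: exp_dominated_def)
  also have "\<dots> = A * exp (- (\<kappa> * s)) * gauss_kernel (- ((\<kappa> + \<rho>) * b)) \<eta> + B * gauss_kernel (- (\<rho> * b)) \<eta>"
    by (simp add: gauss_kernel_def algebra_simps exp_add[symmetric])
  finally show ?thesis .
qed

lemma heat_deriv_integrand_bound:
  assumes "exp_dominated \<kappa> A B g"
  shows "\<bar>gauss_kernel (- (\<rho> * b)) \<eta> * (\<eta> / (2 * b) + \<rho>) * g (s + b * \<eta>)\<bar> \<le>
    A * exp (- (\<kappa> * s)) * (heat_weight \<rho> b \<eta> * gauss_kernel (- ((\<kappa> + \<rho>) * b)) \<eta>) +
    B * (heat_weight \<rho> b \<eta> * gauss_kernel (- (\<rho> * b)) \<eta>)"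
proof -
  have "\<bar>gauss_kernel (- (\<rho> * b)) \<eta> * (\<eta> / (2 * b) + \<rho>) * g (s + b * \<eta>)\<bar> =
      \<bar>\<eta> / (2 * b) + \<rho>\<bar> * \<bar>gauss_kernel (- (\<rho> * b)) \<eta> * g (s + b * \<eta>)\<bar>"
    by (simp add: abs_mult)
  also have "\<dots> \<le> heat_weight \<rho> b \<eta> *
      (A * exp (- (\<kappa> * s)) * gauss_kernel (- ((\<kappa> + \<rho>) * b)) \<eta> + B * gauss_kernel (- (\<rho> * b)) \<eta>)"
    by (intro mult_mono abs_heat_weight heat_integrand_bound[OF assms]) (auto simp: heat_weight_nonneg)
  finally show ?thesis by (simp add: algebra_simps)
qed

lemma heat_integrable:
  assumes g: "exp_dominated \<kappa> A B g"
  shows "integrable lborel (\<lambda>\<eta>. gauss_kernel (- (\<rho> * b)) \<eta> * g (s + b * \<eta>))"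
proof (rule Bochner_Integration.integrable_bound)
  note [measurable] = exp_dominated_measurable[OF g]
  show "(\<lambda>\<eta>. gauss_kernel (- (\<rho> * b)) \<eta> * g (s + b * \<eta>)) \<in> borel_measurable lborel" by measurable
  show "integrable lborel (\<lambda>\<eta>. A * exp (- (\<kappa> * s)) * gauss_kernel (- ((\<kappa> + \<rho>) * b)) \<eta> + B * gauss_kernel (- (\<rho> * b)) \<eta>)"
    by (intro Bochner_Integration.integrable_add integrable_mult_right integrable_gauss_kernel)
  show "AE \<eta> in lborel. norm (gauss_kernel (- (\<rho> * b)) \<eta> * g (s + b * \<eta>)) \<le>
      norm (A * exp (- (\<kappa> * s)) * gauss_kernel (- ((\<kappa> + \<rho>) * b)) \<eta> + B * gauss_kernel (- (\<rho> * b)) \<eta>)"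
    unfolding real_norm_def by (intro AE_I2 order_trans[OF heat_integrand_bound[OF g] abs_ge_self])
qed

lemma heat_deriv_integrable:
  assumes g: "exp_dominated \<kappa> A B g"
  shows "integrable lborel (\<lambda>\<eta>. gauss_kernel (- (\<rho> * b)) \<eta> * (\<eta> / (2 * b) + \<rho>) * g (s + b * \<eta>))"
proof (rule Bochner_Integration.integrable_bound)
  note [measurable] = exp_dominated_measurable[OF g]
  show "(\<lambda>\<eta>. gauss_kernel (- (\<rho> * b)) \<eta> * (\<eta> / (2 * b) + \<rho>) * g (s + b * \<eta>)) \<in> borel_measurable lborel" by measurable
  show "integrable lborel (\<lambda>\<eta>. A * exp (- (\<kappa> * s)) * (heat_weight \<rho> b \<eta> * gauss_kernel (- ((\<kappa> + \<rho>) * b)) \<eta>) +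
      B * (heat_weight \<rho> b \<eta> * gauss_kernel (- (\<rho> * b)) \<eta>))"
    by (intro Bochner_Integration.integrable_add integrable_mult_right integrable_heat_weight)
  show "AE \<eta> in lborel. norm (gauss_kernel (- (\<rho> * b)) \<eta> * (\<eta> / (2 * b) + \<rho>) * g (s + b * \<eta>)) \<le>
      norm (A * exp (- (\<kappa> * s)) * (heat_weight \<rho> b \<eta> * gauss_kernel (- ((\<kappa> + \<rho>) * b)) \<eta>) +
      B * (heat_weight \<rho> b \<eta> * gauss_kernel (- (\<rho> * b)) \<eta>))"
    unfolding real_norm_def by (intro AE_I2 order_trans[OF heat_deriv_integrand_bound[OF g] abs_ge_self])
qed

text \<open>The translation \<open>\<eta> \<mapsto> \<eta> - s / b\<close> moves the parameter \<open>s\<close> into the smooth kernel, so \<open>g\<close> need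
  not be differentiable.\<close>

lemma has_real_derivative_gauss_average:
  assumes g: "exp_dominated \<kappa> A B g" and b: "b \<noteq> 0"
  shows "((\<lambda>s. LINT \<eta>|lborel. gauss_kernel (- (\<rho> * b)) \<eta> * g (s + b * \<eta>)) has_real_derivative
     (LINT \<eta>|lborel. gauss_kernel (- (\<rho> * b)) \<eta> * (\<eta> / (2 * b) + \<rho>) * g (s0 + b * \<eta>))) (at s0)"
proof -
  note [measurable] = exp_dominated_measurable[OF g]
  define f where "f s \<eta> = gauss_kernel (- (\<rho> * b)) (\<eta> - s / b) * g (b * \<eta>)" for s \<eta>
  define f' where "f' s \<eta> = gauss_kernel (- (\<rho> * b)) (\<eta> - s / b) * ((\<eta> - s / b) / (2 * b) + \<rho>) * g (b * \<eta>)" for s \<eta>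
  have shift: "(LINT \<eta>|lborel. F \<eta> * g (s + b * \<eta>)) = (LINT \<eta>|lborel. F (\<eta> - s / b) * g (b * \<eta>))"
    for F s
    using b by (subst lborel_integral_real_affine[of 1 _ "- s / b"]) (simp_all add: algebra_simps)
  have int: "integrable lborel (f s)" for s
  proof -
    have "integrable lborel (\<lambda>\<eta>. gauss_kernel (- (\<rho> * b)) (- s / b + 1 * \<eta>) * g (s + b * (- s / b + 1 * \<eta>)))"
      by (rule lborel_integrable_real_affine[OF heat_integrable[OF g]]) simp
    then show ?thesis using b by (simp add: f_def[abs_def] algebra_simps)
  qed
  \<comment> \<open>For \<open>s\<close> in the unit ball around \<open>s0\<close>, \<open>m\<close>
    bounds \<open>\<bar>s / b\<bar>\<close>. The constants below collect the kernel, its derivative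
    factor and the growth of \<open>g\<close> into one majorant that does not depend on
    \<open>s\<close>.\<close>
  define m where "m = (\<bar>s0\<bar> + 1) / \<bar>b\<bar>"
  define L where "L = 1 / (2 * \<bar>b\<bar>) + \<bar>\<rho>\<bar>"
  define k where "k = \<bar>\<rho> * b\<bar> + 1 + \<bar>\<kappa> * b\<bar>"
  define K where "K = L * (A + B) * exp (m\<^sup>2 / 4 + (\<bar>\<rho> * b\<bar> + 1) * m)"
  \<comment> \<open>Two Gaussians with opposite tilts replace
    \<open>exp (k * \<bar>\<eta>\<bar>)\<close>, so that \<open>integrable_gaussian\<close>
    applies.\<close>
  define w where "w \<eta> = K * (exp (- (1 / 8 * \<eta>\<^sup>2) + k * \<eta>) + exp (- (1 / 8 * \<eta>\<^sup>2) + (- k) * \<eta>))" for \<eta>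
  have AB: "0 \<le> A" "0 \<le> B" using g by (auto simp: exp_dominated_def)
  have L0: "0 \<le> L" by (simp add: L_def)
  have bound: "\<bar>f' s \<eta>\<bar> \<le> w \<eta>" if s: "s \<in> ball s0 1" for s \<eta>
  proof -
    define z where "z = \<eta> - s / b"
    have "\<bar>s\<bar> \<le> \<bar>s0\<bar> + 1" using s by (auto simp: dist_real_def)
    then have sm: "\<bar>s / b\<bar> \<le> m" using b by (simp add: m_def divide_right_mono)
    have m0: "0 \<le> m" by (simp add: m_def)
    have zm: "\<bar>z\<bar> \<le> \<bar>\<eta>\<bar> + m" using sm unfolding z_def by linarith
    \<comment> \<open>Half of the Gaussian decay survives the translation, which is the source of
      the coefficient \<open>1 / 8\<close>.\<close>
    have z2: "\<eta>\<^sup>2 / 2 - m\<^sup>2 \<le> z\<^sup>2"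
    proof -
      have "\<eta>\<^sup>2 = (z + s / b)\<^sup>2" by (simp add: z_def)
      also have "\<dots> \<le> 2 * z\<^sup>2 + 2 * (s / b)\<^sup>2"
        using zero_le_power2[of "z - s / b"] unfolding power2_diff power2_sum by linarith
      also have "(s / b)\<^sup>2 \<le> m\<^sup>2" using sm m0 by (simp add: abs_le_square_iff[symmetric])
      finally show ?thesis by simp
    qed
    have 1: "gauss_kernel (- (\<rho> * b)) z \<le> exp (- (z\<^sup>2 / 4) + \<bar>\<rho> * b\<bar> * \<bar>z\<bar>)"
      unfolding gauss_kernel_def using abs_ge_self[of "- (\<rho> * b) * z"] by (simp add: abs_mult)
    have 2: "\<bar>z / (2 * b) + \<rho>\<bar> \<le> L * exp \<bar>z\<bar>"
    proof -
      have "\<bar>z / (2 * b) + \<rho>\<bar> \<le> 1 / (2 * \<bar>b\<bar>) * \<bar>z\<bar> + \<bar>\<rho>\<bar> * 1"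
        using abs_heat_weight[of z b \<rho>] by (simp add: heat_weight_def)
      also have "\<dots> \<le> 1 / (2 * \<bar>b\<bar>) * exp \<bar>z\<bar> + \<bar>\<rho>\<bar> * exp \<bar>z\<bar>"
        using order_trans[OF _ exp_ge_add_one_self[of "\<bar>z\<bar>"], of "\<bar>z\<bar>"]
        by (intro add_mono mult_left_mono) auto
      finally show ?thesis by (simp add: L_def algebra_simps)
    qed
    have 3: "\<bar>g (b * \<eta>)\<bar> \<le> (A + B) * exp (\<bar>\<kappa> * b\<bar> * \<bar>\<eta>\<bar>)"
    proof -
      have "\<bar>g (b * \<eta>)\<bar> \<le> A * exp (- (\<kappa> * (b * \<eta>))) + B * 1" using g by (auto simp: exp_dominated_def)
      also have "\<dots> \<le> A * exp (\<bar>\<kappa> * b\<bar> * \<bar>\<eta>\<bar>) + B * exp (\<bar>\<kappa> * b\<bar> * \<bar>\<eta>\<bar>)"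
        using AB abs_ge_self[of "- (\<kappa> * (b * \<eta>))"]
        by (intro add_mono mult_left_mono) (auto simp: abs_mult mult.assoc)
      finally show ?thesis by (simp add: algebra_simps)
    qed
    have "\<bar>f' s \<eta>\<bar> = gauss_kernel (- (\<rho> * b)) z * \<bar>z / (2 * b) + \<rho>\<bar> * \<bar>g (b * \<eta>)\<bar>"
      using gauss_kernel_pos[of "- (\<rho> * b)" z] by (simp add: f'_def z_def abs_mult)
    also have "\<dots> \<le> exp (- (z\<^sup>2 / 4) + \<bar>\<rho> * b\<bar> * \<bar>z\<bar>) * (L * exp \<bar>z\<bar>) * ((A + B) * exp (\<bar>\<kappa> * b\<bar> * \<bar>\<eta>\<bar>))"
      using 1 2 3 gauss_kernel_pos[of "- (\<rho> * b)" z] L0 by (intro mult_mono) auto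
    also have "\<dots> = L * (A + B) * exp (- (z\<^sup>2 / 4) + (\<bar>\<rho> * b\<bar> + 1) * \<bar>z\<bar> + \<bar>\<kappa> * b\<bar> * \<bar>\<eta>\<bar>)"
    proof -
      have "exp ((\<bar>\<rho> * b\<bar> + 1) * \<bar>z\<bar>) = exp (\<bar>\<rho> * b\<bar> * \<bar>z\<bar>) * exp \<bar>z\<bar>"
        by (simp add: distrib_right exp_add)
      then show ?thesis by (simp only: exp_add mult_ac)
    qed
    also have "\<dots> \<le> L * (A + B) * exp (- (1 / 8 * \<eta>\<^sup>2) + m\<^sup>2 / 4 + (\<bar>\<rho> * b\<bar> + 1) * (\<bar>\<eta>\<bar> + m) + \<bar>\<kappa> * b\<bar> * \<bar>\<eta>\<bar>)"
    proof -
      have "(\<bar>\<rho> * b\<bar> + 1) * \<bar>z\<bar> \<le> (\<bar>\<rho> * b\<bar> + 1) * (\<bar>\<eta>\<bar> + m)" using zm by (intro mult_left_mono) auto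
      then show ?thesis using z2 AB L0 by (intro mult_left_mono) auto
    qed
    also have "\<dots> = K * exp (- (1 / 8 * \<eta>\<^sup>2) + k * \<bar>\<eta>\<bar>)"
    proof -
      have "- (1 / 8 * \<eta>\<^sup>2) + m\<^sup>2 / 4 + (\<bar>\<rho> * b\<bar> + 1) * (\<bar>\<eta>\<bar> + m) + \<bar>\<kappa> * b\<bar> * \<bar>\<eta>\<bar> =
          (m\<^sup>2 / 4 + (\<bar>\<rho> * b\<bar> + 1) * m) + (- (1 / 8 * \<eta>\<^sup>2) + k * \<bar>\<eta>\<bar>)"
        by (simp add: k_def algebra_simps)
      then show ?thesis by (simp only: K_def exp_add mult.assoc)
    qed
    also have "\<dots> \<le> w \<eta>"
      using AB L0 by (cases "\<eta> \<ge> 0") (auto simp: w_def K_def intro!: mult_left_mono)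
    finally show ?thesis .
  qed
  have "((\<lambda>s. integral\<^sup>L lborel (f s)) has_real_derivative integral\<^sup>L lborel (f' s0)) (at s0)"
  proof (rule has_real_derivative_integral[where d = 1 and w = w])
    show "((\<lambda>s. f s \<eta>) has_real_derivative f' s \<eta>) (at s)" for s \<eta>
      unfolding f_def f'_def gauss_kernel_def using b
      by (auto intro!: derivative_eq_intros simp: field_simps power2_eq_square)
    show "integrable lborel w"
      unfolding w_def
      by (intro integrable_mult_right Bochner_Integration.integrable_add integrable_gaussian) auto
    show "f' s0 \<in> borel_measurable lborel" unfolding f'_def by measurable
  qed (use int bound in auto)
  then show ?thesis unfolding f_def f'_def by (simp only: shift)
qed

section \<open>The flow and its action on exponentials\<close>

locale discounted_heat =
  fixes a \<rho> \<beta> :: real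
  assumes a_nz: "a \<noteq> 0"
begin

text \<open>This is the semigroup with generator
  \<open>a\<^sup>2 * f'' - 2 * \<rho> * a\<^sup>2 * f' + rate 0 * f\<close>, written through its
  Gaussian kernel.\<close>

definition heat :: "real \<Rightarrow> (real \<Rightarrow> real) \<Rightarrow> real \<Rightarrow> real" where
  "heat t g s = exp (\<beta> * t) / (2 * sqrt pi) *
     (LINT \<eta>|lborel. gauss_kernel (- (\<rho> * (a * sqrt t))) \<eta> * g (s + a * sqrt t * \<eta>))"

text \<open>The spatial derivative of \<open>heat\<close>, with the derivative carried by the
  kernel; it has this meaning for positive \<open>t\<close> only.\<close>

definition heat_deriv :: "real \<Rightarrow> (real \<Rightarrow> real) \<Rightarrow> real \<Rightarrow> real" where
  "heat_deriv t g s = exp (\<beta> * t) / (2 * sqrt pi) *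
     (LINT \<eta>|lborel. gauss_kernel (- (\<rho> * (a * sqrt t))) \<eta> * (\<eta> / (2 * (a * sqrt t)) + \<rho>) * g (s + a * sqrt t * \<eta>))"

text \<open>The eigenvalue of the generator at \<open>exp (- (\<kappa> * u))\<close>. With market
  constants and \<open>\<kappa> = 1 - q\<close> it is \<open>lambda_rate\<close> at
  \<open>q\<close>, and \<open>rate 0\<close> is \<open>- r\<close>.\<close>

definition rate :: "real \<Rightarrow> real" where
  "rate \<kappa> = \<beta> + (\<kappa> + \<rho>)\<^sup>2 * a\<^sup>2"

text \<open>The exact flow of the dominating function \<open>A * exp (- (\<kappa> * u)) + B\<close>,
  as \<open>heat_envelope\<close> shows.\<close>

definition envelope :: "real \<Rightarrow> real \<Rightarrow> real \<Rightarrow> real \<Rightarrow> real \<Rightarrow> real" where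
  "envelope \<kappa> A B s t = A * exp (- (\<kappa> * s)) * exp (rate \<kappa> * t) + B * exp (rate 0 * t)"

text \<open>The price of one spatial derivative relative to the envelope. It is integrable at time
  zero and decreasing in positive \<open>t\<close>; the term \<open>2 * \<bar>\<rho>\<bar>\<close>
  comes from bounding \<open>\<bar>\<kappa> + \<rho>\<bar> + \<bar>\<rho>\<bar>\<close>.\<close>

definition slope :: "real \<Rightarrow> real \<Rightarrow> real" where
  "slope \<kappa> t = \<bar>\<kappa>\<bar> + 2 * \<bar>\<rho>\<bar> + exp 1 / \<bar>a\<bar> / sqrt t"

lemma slope_nonneg: "t \<ge> 0 \<Longrightarrow> 0 \<le> slope \<kappa> t"
  by (simp add: slope_def)

text \<open>The squared tilt is linear in \<open>t\<close>, so the mass of the tilted kernel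
  combines with the discount into a single exponential.\<close>

lemma exp_rate:
  assumes "t \<ge> 0"
  shows "exp (\<beta> * t) / (2 * sqrt pi) * (2 * sqrt pi * exp ((- ((\<kappa> + \<rho>) * (a * sqrt t)))\<^sup>2)) = exp (rate \<kappa> * t)"
proof -
  have "(- ((\<kappa> + \<rho>) * (a * sqrt t)))\<^sup>2 = (\<kappa> + \<rho>)\<^sup>2 * a\<^sup>2 * t"
    using assms by (simp only: power2_minus power_mult_distrib real_sqrt_pow2 mult.assoc)
  then show ?thesis by (simp add: rate_def exp_add[symmetric] distrib_right)
qed

lemma exp_rate0:
  "t \<ge> 0 \<Longrightarrow> exp (\<beta> * t) / (2 * sqrt pi) * (2 * sqrt pi * exp ((- (\<rho> * (a * sqrt t)))\<^sup>2)) = exp (rate 0 * t)"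
  using exp_rate[of t 0] by simp

lemma heat_envelope:
  assumes "t \<ge> 0"
  shows "heat t (\<lambda>u. A * exp (- (\<kappa> * u)) + B) s = envelope \<kappa> A B s t"
proof -
  have "gauss_kernel (- (\<rho> * b)) \<eta> * (A * exp (- (\<kappa> * (s + b * \<eta>))) + B) =
     A * exp (- (\<kappa> * s)) * gauss_kernel (- ((\<kappa> + \<rho>) * b)) \<eta> + B * gauss_kernel (- (\<rho> * b)) \<eta>" for b \<eta>
    by (simp add: gauss_kernel_def algebra_simps exp_add[symmetric])
  then have "heat t (\<lambda>u. A * exp (- (\<kappa> * u)) + B) s = exp (\<beta> * t) / (2 * sqrt pi) *
      (A * exp (- (\<kappa> * s)) * (2 * sqrt pi * exp ((- ((\<kappa> + \<rho>) * (a * sqrt t)))\<^sup>2)) +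
       B * (2 * sqrt pi * exp ((- (\<rho> * (a * sqrt t)))\<^sup>2)))"
    by (simp add: heat_def integrable_gauss_kernel integral_gauss_kernel)
  also have "\<dots> = envelope \<kappa> A B s t"
    unfolding envelope_def exp_rate[OF assms, symmetric] exp_rate0[OF assms, symmetric]
    by (simp add: algebra_simps)
  finally show ?thesis .
qed

lemma heat_exp: "t \<ge> 0 \<Longrightarrow> heat t (\<lambda>u. exp (- (\<kappa> * u))) s = exp (- (\<kappa> * s)) * exp (rate \<kappa> * t)"
  using heat_envelope[of t 1 \<kappa> 0 s] by (simp add: envelope_def)

lemma exp_dominated_affine: "A \<ge> 0 \<Longrightarrow> B \<ge> 0 \<Longrightarrow> exp_dominated \<kappa> A B (\<lambda>u. A * exp (- (\<kappa> * u)) + B)"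
  by (auto simp: exp_dominated_def intro!: continuous_intros)

lemma exp_dominated_exp: "exp_dominated \<kappa> 1 0 (\<lambda>u. exp (- (\<kappa> * u)))"
  by (auto simp: exp_dominated_def intro!: continuous_intros)

lemma heat_mono:
  assumes "exp_dominated \<kappa> A B g" "exp_dominated \<kappa>' A' B' k" "\<And>u. g u \<le> k u"
  shows "heat t g s \<le> heat t k s"
proof -
  have "gauss_kernel c \<eta> * g (s + b * \<eta>) \<le> gauss_kernel c \<eta> * k (s + b * \<eta>)" for c b \<eta>
    using assms(3)[of "s + b * \<eta>"] gauss_kernel_pos[of c \<eta>] by (intro mult_left_mono) (auto simp: algebra_simps)
  then have "(LINT \<eta>|lborel. gauss_kernel (- (\<rho> * b)) \<eta> * g (s + b * \<eta>)) \<le>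
      (LINT \<eta>|lborel. gauss_kernel (- (\<rho> * b)) \<eta> * k (s + b * \<eta>))" for b
    by (intro integral_mono heat_integrable[OF assms(1)] heat_integrable[OF assms(2)]) auto
  then show ?thesis
    unfolding heat_def by (intro mult_left_mono) auto
qed

lemma heat_diff:
  assumes "exp_dominated \<kappa> A B g" "exp_dominated \<kappa>' A' B' k"
  shows "heat t (\<lambda>u. g u - k u) s = heat t g s - heat t k s"
  unfolding heat_def right_diff_distrib
  by (simp add: heat_integrable[OF assms(1)] heat_integrable[OF assms(2)] right_diff_distrib)

lemma heat_deriv_diff:
  assumes "exp_dominated \<kappa> A B g" "exp_dominated \<kappa>' A' B' k"
  shows "heat_deriv t (\<lambda>u. g u - k u) s = heat_deriv t g s - heat_deriv t k s"
  unfolding heat_deriv_def right_diff_distrib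
  by (simp add: heat_deriv_integrable[OF assms(1)] heat_deriv_integrable[OF assms(2)] right_diff_distrib)

text \<open>Monotonicity of the flow, applied to \<open>g\<close> and to \<open>- g\<close> against
  the dominating function whose flow is known exactly.\<close>

lemma heat_abs_le:
  assumes g: "exp_dominated \<kappa> A B g" and "t \<ge> 0"
  shows "\<bar>heat t g s\<bar> \<le> envelope \<kappa> A B s t"
proof -
  have AB: "0 \<le> A" "0 \<le> B" using g by (auto simp: exp_dominated_def)
  have g': "exp_dominated \<kappa> A B (\<lambda>u. - g u)"
    using g by (auto simp: exp_dominated_def intro!: continuous_intros)
  have "g u \<le> A * exp (- (\<kappa> * u)) + B" "- g u \<le> A * exp (- (\<kappa> * u)) + B" for u
    using g by (auto simp: exp_dominated_def dest!: spec[of _ u])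
  then have "heat t g s \<le> heat t (\<lambda>u. A * exp (- (\<kappa> * u)) + B) s"
    and "heat t (\<lambda>u. - g u) s \<le> heat t (\<lambda>u. A * exp (- (\<kappa> * u)) + B) s"
    by (auto intro!: heat_mono[OF g exp_dominated_affine[OF AB]] heat_mono[OF g' exp_dominated_affine[OF AB]])
  moreover have "heat t (\<lambda>u. - g u) s = - heat t g s" by (simp add: heat_def)
  ultimately show ?thesis using heat_envelope[OF \<open>t \<ge> 0\<close>] by (simp add: abs_le_iff)
qed

text \<open>The weighted moments are divided by
  \<open>\<bar>b\<bar> = \<bar>a\<bar> * sqrt t\<close>. Their tilts are multiples of
  \<open>b\<close>, so only the constant \<open>exp 1\<close> keeps the factor
  \<open>1 / sqrt t\<close>.\<close>

lemma heat_deriv_abs_le: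
  assumes g: "exp_dominated \<kappa> A B g" and t: "t > 0"
  shows "\<bar>heat_deriv t g s\<bar> \<le> slope \<kappa> t * envelope \<kappa> A B s t"
proof -
  have AB: "0 \<le> A" "0 \<le> B" using g by (auto simp: exp_dominated_def)
  define b where "b = a * sqrt t"
  have b: "b \<noteq> 0" "\<bar>b\<bar> = \<bar>a\<bar> * sqrt t" using a_nz t by (auto simp: b_def abs_mult)
  define E where "E = exp (\<beta> * t) / (2 * sqrt pi)"
  have E: "E > 0" by (simp add: E_def)
  let ?c1 = "- ((\<kappa> + \<rho>) * b)" and ?c0 = "- (\<rho> * b)"
  have sl: "\<bar>?c1\<bar> / \<bar>b\<bar> + \<bar>\<rho>\<bar> + exp 1 / \<bar>b\<bar> \<le> slope \<kappa> t" "\<bar>?c0\<bar> / \<bar>b\<bar> + \<bar>\<rho>\<bar> + exp 1 / \<bar>b\<bar> \<le> slope \<kappa> t"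
    using b by (auto simp: slope_def abs_mult)
  have i: "(LINT \<eta>|lborel. heat_weight \<rho> b \<eta> * gauss_kernel c \<eta>) \<le> 2 * sqrt pi * exp (c\<^sup>2) * slope \<kappa> t"
    if "c = ?c0 \<or> c = ?c1" for c
    using that sl by (intro order_trans[OF integral_heat_weight_le[OF b(1)]] mult_left_mono) auto
  have "\<bar>heat_deriv t g s\<bar> = E * \<bar>LINT \<eta>|lborel. gauss_kernel ?c0 \<eta> * (\<eta> / (2 * b) + \<rho>) * g (s + b * \<eta>)\<bar>"
    using E by (simp add: heat_deriv_def b_def E_def abs_mult)
  also have "\<dots> \<le> E * (LINT \<eta>|lborel. \<bar>gauss_kernel ?c0 \<eta> * (\<eta> / (2 * b) + \<rho>) * g (s + b * \<eta>)\<bar>)"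
    using E by (intro mult_left_mono integral_abs_bound) auto
  also have "\<dots> \<le> E * (LINT \<eta>|lborel. A * exp (- (\<kappa> * s)) * (heat_weight \<rho> b \<eta> * gauss_kernel ?c1 \<eta>) +
      B * (heat_weight \<rho> b \<eta> * gauss_kernel ?c0 \<eta>))"
    using E by (intro mult_left_mono integral_mono integrable_abs heat_deriv_integrable[OF g]
        heat_deriv_integrand_bound[OF g] Bochner_Integration.integrable_add integrable_mult_right
        integrable_heat_weight) auto
  also have "\<dots> = E * (A * exp (- (\<kappa> * s)) * (LINT \<eta>|lborel. heat_weight \<rho> b \<eta> * gauss_kernel ?c1 \<eta>) +
      B * (LINT \<eta>|lborel. heat_weight \<rho> b \<eta> * gauss_kernel ?c0 \<eta>))"
    by (simp add: integrable_heat_weight)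
  also have "\<dots> \<le> E * (A * exp (- (\<kappa> * s)) * (2 * sqrt pi * exp (?c1\<^sup>2) * slope \<kappa> t) +
      B * (2 * sqrt pi * exp (?c0\<^sup>2) * slope \<kappa> t))"
    using E AB by (intro mult_left_mono add_mono i) auto
  also have "\<dots> = slope \<kappa> t * (A * exp (- (\<kappa> * s)) * (E * (2 * sqrt pi * exp (?c1\<^sup>2))) + B * (E * (2 * sqrt pi * exp (?c0\<^sup>2))))"
    by (simp add: algebra_simps)
  also have "\<dots> = slope \<kappa> t * envelope \<kappa> A B s t"
    unfolding E_def b_def envelope_def using t by (subst exp_rate exp_rate0, simp)+ simp
  finally show ?thesis .
qed

lemma has_real_derivative_heat:
  assumes "exp_dominated \<kappa> A B g" "t > 0"
  shows "(heat t g has_real_derivative heat_deriv t g s) (at s)"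
  unfolding heat_def[abs_def] heat_deriv_def
  using assms(2) a_nz by (intro DERIV_cmult has_real_derivative_gauss_average[OF assms(1)]) auto

text \<open>Differentiates the closed form \<open>heat_exp\<close> instead of evaluating the kernel
  integral.\<close>

lemma heat_deriv_exp:
  assumes "t > 0"
  shows "heat_deriv t (\<lambda>u. exp (- (\<kappa> * u))) s = - \<kappa> * exp (- (\<kappa> * s)) * exp (rate \<kappa> * t)"
proof (rule DERIV_unique)
  show "(heat t (\<lambda>u. exp (- (\<kappa> * u))) has_real_derivative heat_deriv t (\<lambda>u. exp (- (\<kappa> * u))) s) (at s)"
    by (rule has_real_derivative_heat[OF exp_dominated_exp assms])
  show "(heat t (\<lambda>u. exp (- (\<kappa> * u))) has_real_derivative - \<kappa> * exp (- (\<kappa> * s)) * exp (rate \<kappa> * t)) (at s)"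
  proof -
    have "heat t (\<lambda>u. exp (- (\<kappa> * u))) = (\<lambda>s. exp (- (\<kappa> * s)) * exp (rate \<kappa> * t))"
      using assms by (intro ext heat_exp) simp
    then show ?thesis by (auto intro!: derivative_eq_intros)
  qed
qed

text \<open>A convergent sequence is bounded below, and for \<open>\<kappa> \<ge> 0\<close> the
  bound on the integrand decreases in \<open>s\<close>; its value at the lower bound serves as
  majorant for the whole sequence.\<close>

lemma heat_deriv_tendsto:
  assumes g: "exp_dominated \<kappa> A B g" and \<kappa>: "\<kappa> \<ge> 0" and S: "X \<longlonglongrightarrow> S"
  shows "(\<lambda>n. heat_deriv t g (X n)) \<longlonglongrightarrow> heat_deriv t g S"
proof -
  note [measurable] = exp_dominated_measurable[OF g]
  have AB: "0 \<le> A" "0 \<le> B" using g by (auto simp: exp_dominated_def)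
  have "Bseq X" using S by (intro convergent_imp_Bseq) (auto simp: convergent_def)
  then obtain M where M: "\<And>n. \<bar>X n\<bar> \<le> M" by (auto simp: Bseq_def)
  then have m: "- M \<le> X n" for n using abs_le_D2[OF M[of n]] by linarith
  define b where "b = a * sqrt t"
  have "(\<lambda>n. LINT \<eta>|lborel. gauss_kernel (- (\<rho> * b)) \<eta> * (\<eta> / (2 * b) + \<rho>) * g (X n + b * \<eta>))
     \<longlonglongrightarrow> (LINT \<eta>|lborel. gauss_kernel (- (\<rho> * b)) \<eta> * (\<eta> / (2 * b) + \<rho>) * g (S + b * \<eta>))"
  proof (rule integral_dominated_convergence[where w = "\<lambda>\<eta>.
        A * exp (- (\<kappa> * (- M))) * (heat_weight \<rho> b \<eta> * gauss_kernel (- ((\<kappa> + \<rho>) * b)) \<eta>) +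
        B * (heat_weight \<rho> b \<eta> * gauss_kernel (- (\<rho> * b)) \<eta>)"])
    show "AE \<eta> in lborel. norm (gauss_kernel (- (\<rho> * b)) \<eta> * (\<eta> / (2 * b) + \<rho>) * g (X n + b * \<eta>)) \<le>
        A * exp (- (\<kappa> * (- M))) * (heat_weight \<rho> b \<eta> * gauss_kernel (- ((\<kappa> + \<rho>) * b)) \<eta>) +
        B * (heat_weight \<rho> b \<eta> * gauss_kernel (- (\<rho> * b)) \<eta>)" for n
      unfolding real_norm_def using AB mult_left_mono[OF m[of n] \<kappa>]
      by (intro AE_I2 order_trans[OF heat_deriv_integrand_bound[OF g]] add_right_mono mult_right_mono mult_left_mono)
        (auto intro!: mult_nonneg_nonneg heat_weight_nonneg less_imp_le[OF gauss_kernel_pos])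
    show "AE \<eta> in lborel. (\<lambda>n. gauss_kernel (- (\<rho> * b)) \<eta> * (\<eta> / (2 * b) + \<rho>) * g (X n + b * \<eta>))
       \<longlonglongrightarrow> gauss_kernel (- (\<rho> * b)) \<eta> * (\<eta> / (2 * b) + \<rho>) * g (S + b * \<eta>)"
      by (intro AE_I2 tendsto_intros exp_dominated_tendsto[OF g] S)
  qed (auto intro!: integrable_heat_weight)
  then show ?thesis unfolding heat_deriv_def b_def by (intro tendsto_intros)
qed

lemma heat_measurable:
  assumes g: "exp_dominated \<kappa> A B g"
  shows "(\<lambda>t. heat t g s) \<in> borel_measurable borel" "(\<lambda>t. heat_deriv t g s) \<in> borel_measurable borel"
proof -
  note [measurable] = exp_dominated_measurable[OF g]
  show "(\<lambda>t. heat t g s) \<in> borel_measurable borel" "(\<lambda>t. heat_deriv t g s) \<in> borel_measurable borel"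
    unfolding heat_def heat_deriv_def gauss_kernel_def by measurable
qed

end

section \<open>Accumulated flow and long-time limits\<close>

text \<open>The properties of \<open>g u = - V' (exp u)\<close> that the analysis uses. The limit at
  \<open>at_bot\<close> is the hypothesis on \<open>V'\<close> near zero, with
  \<open>\<kappa> = 1 - q\<close>.\<close>

definition marginal :: "real \<Rightarrow> (real \<Rightarrow> real) \<Rightarrow> bool" where
  "marginal \<kappa> g \<longleftrightarrow> continuous_on UNIV g \<and> antimono g \<and> (\<forall>u. 0 \<le> g u) \<and>
     (g \<longlongrightarrow> 0) at_top \<and> ((\<lambda>u. g u * exp (\<kappa> * u)) \<longlongrightarrow> 1) at_bot"

text \<open>To the left of some \<open>M\<close> the asymptotics give relative error \<epsilon>; to
  the right both functions are bounded by their values at \<open>M\<close>. A small exponential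
  coefficient matters when \<open>rate \<kappa> = 0\<close>, because the flow does not damp that
  part.\<close>

lemma marginal_near_exp:
  assumes g: "marginal \<kappa> g" and "\<kappa> \<ge> 0" and e: "\<epsilon> > 0"
  shows "\<exists>C. exp_dominated \<kappa> \<epsilon> C (\<lambda>u. g u - exp (- (\<kappa> * u)))"
proof -
  have "\<forall>\<^sub>F u in at_bot. \<bar>g u * exp (\<kappa> * u) - 1\<bar> < \<epsilon>"
    using g e by (auto simp: marginal_def dest: tendstoD[of _ _ _ \<epsilon>] simp: dist_real_def)
  then obtain M where M: "\<And>u. u \<le> M \<Longrightarrow> \<bar>g u * exp (\<kappa> * u) - 1\<bar> < \<epsilon>"
    by (auto simp: eventually_at_bot_linorder)
  define C where "C = g M + exp (- (\<kappa> * M))"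
  have pos: "0 \<le> g u" for u using g by (auto simp: marginal_def)
  have "\<bar>g u - exp (- (\<kappa> * u))\<bar> \<le> \<epsilon> * exp (- (\<kappa> * u)) + C" for u
  proof (cases "u \<le> M")
    case True
    have "g u - exp (- (\<kappa> * u)) = (g u * exp (\<kappa> * u) - 1) * exp (- (\<kappa> * u))"
      by (simp add: left_diff_distrib mult.assoc exp_add[symmetric])
    then have "\<bar>g u - exp (- (\<kappa> * u))\<bar> = \<bar>g u * exp (\<kappa> * u) - 1\<bar> * exp (- (\<kappa> * u))"
      by (simp add: abs_mult)
    also have "\<dots> \<le> \<epsilon> * exp (- (\<kappa> * u))" using M[OF True] by (intro mult_right_mono) auto
    finally show ?thesis using pos[of M] by (simp add: C_def add_increasing2)
  next
    case False
    have "antimono g" using g by (simp add: marginal_def)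
    with False have "g u \<le> g M" by (auto elim: antimonoD)
    moreover have "exp (- (\<kappa> * u)) \<le> exp (- (\<kappa> * M))"
      using False \<open>\<kappa> \<ge> 0\<close> by (simp add: mult_left_mono)
    moreover have "0 \<le> \<epsilon> * exp (- (\<kappa> * u))" using e by simp
    ultimately show ?thesis using pos[of u] exp_gt_zero[of "- (\<kappa> * u)"] unfolding C_def by linarith
  qed
  moreover have "0 \<le> C" using pos[of M] by (simp add: C_def)
  ultimately have "exp_dominated \<kappa> \<epsilon> C (\<lambda>u. g u - exp (- (\<kappa> * u)))"
    using g e unfolding exp_dominated_def marginal_def by (auto intro!: continuous_intros)
  then show ?thesis ..
qed

text \<open>Here the constant part is the small one, thanks to the decay of \<open>g\<close> at
  infinity, while the exponential coefficient may be large.\<close>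

lemma marginal_dominated:
  assumes g: "marginal \<kappa> g" and "\<kappa> \<ge> 0" and e: "\<epsilon> > 0"
  shows "\<exists>C. exp_dominated \<kappa> C \<epsilon> g"
proof -
  obtain C1 where C1: "exp_dominated \<kappa> 1 C1 (\<lambda>u. g u - exp (- (\<kappa> * u)))"
    using marginal_near_exp[OF g \<open>\<kappa> \<ge> 0\<close>, of 1] by auto
  have "\<forall>\<^sub>F u in at_top. \<bar>g u\<bar> < \<epsilon>"
    using g e by (auto simp: marginal_def dest: tendstoD[of _ _ _ \<epsilon>] simp: dist_real_def)
  then obtain M where M: "\<And>u. u \<ge> M \<Longrightarrow> \<bar>g u\<bar> < \<epsilon>" by (auto simp: eventually_at_top_linorder)
  have C1_0: "0 \<le> C1" using C1 by (auto simp: exp_dominated_def)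
  \<comment> \<open>The 2 comes from the exponential itself plus its unit relative error; for
    \<open>u < M\<close> the constant \<open>C1\<close> is at most
    \<open>C1 * exp (\<kappa> * M)\<close> times \<open>exp (- (\<kappa> * u))\<close>.\<close>
  define C where "C = 2 + C1 * exp (\<kappa> * M)"
  have C0: "0 \<le> C" using C1_0 by (simp add: C_def)
  have "\<bar>g u\<bar> \<le> C * exp (- (\<kappa> * u)) + \<epsilon>" for u
  proof (cases "u \<ge> M")
    case True
    with M[of u] C0 show ?thesis by (simp add: add_increasing)
  next
    case False
    have "\<bar>g u - exp (- (\<kappa> * u))\<bar> \<le> 1 * exp (- (\<kappa> * u)) + C1" using C1 by (auto simp: exp_dominated_def)
    then have "\<bar>g u\<bar> \<le> 2 * exp (- (\<kappa> * u)) + C1 * 1" using exp_gt_zero[of "- (\<kappa> * u)"] by linarith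
    also have "\<dots> \<le> 2 * exp (- (\<kappa> * u)) + C1 * exp (\<kappa> * M - \<kappa> * u)"
      using False \<open>\<kappa> \<ge> 0\<close> C1_0 by (intro add_left_mono mult_left_mono) (auto intro: mult_left_mono)
    also have "\<dots> = C * exp (- (\<kappa> * u))" by (simp add: C_def algebra_simps exp_diff exp_minus field_simps)
    finally show ?thesis using e by simp
  qed
  then have "exp_dominated \<kappa> C \<epsilon> g" using g e C0 by (auto simp: exp_dominated_def marginal_def)
  then show ?thesis ..
qed

text \<open>Otherwise each value of \<open>g\<close> is bounded by the values along steps of length
  \<open>d\<close>, which tend to zero. Then \<open>g\<close> vanishes, against its asymptotics at
  minus infinity.\<close>

lemma marginal_strict_somewhere:
  assumes g: "marginal \<kappa> g" and d: "d > 0"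
  shows "\<exists>u. g (u + d) < g u"
proof (rule ccontr)
  assume "\<not> ?thesis"
  then have le: "g u \<le> g (u + d)" for u by (auto simp: not_less)
  have "g u = 0" for u
  proof -
    have step: "g u \<le> g (u + real n * d)" for n
    proof (induction n)
      case (Suc n)
      then show ?case using le[of "u + real n * d"] by (simp add: algebra_simps)
    qed simp
    have "filterlim (\<lambda>n. u + real n * d) at_top sequentially"
      using d by (intro filterlim_tendsto_add_at_top[OF tendsto_const]
          filterlim_at_top_mult_tendsto_pos[OF tendsto_const] filterlim_real_sequentially)
    then have "(\<lambda>n. g (u + real n * d)) \<longlonglongrightarrow> 0"
      using g filterlim_compose[of g] by (auto simp: marginal_def)
    then have "g u \<le> 0" using step by (intro tendsto_lowerbound) auto
    with g show ?thesis by (auto simp: marginal_def intro: antisym)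
  qed
  with g show False by (auto simp: marginal_def tendsto_const_iff)
qed

section \<open>Integrals of the flow over time\<close>

locale transient_heat = discounted_heat +
  assumes rate0: "rate 0 < 0"
begin

text \<open>The time set enters as an indicator, so finite and infinite horizons are integrals over
  one space and share a dominating function.\<close>

definition time_heat :: "real set \<Rightarrow> (real \<Rightarrow> real) \<Rightarrow> real \<Rightarrow> real" where
  "time_heat J g s = (LINT t|lborel. indicator J t * heat t g s)"

definition time_heat_deriv :: "real set \<Rightarrow> (real \<Rightarrow> real) \<Rightarrow> real \<Rightarrow> real" where
  "time_heat_deriv J g s = (LINT t|lborel. indicator J t * heat_deriv t g s)"

lemma integrable_envelope:
  assumes "rate \<kappa> < 0"
  shows "integrable lborel (\<lambda>t. indicator {0<..} t * envelope \<kappa> A B s t)"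
proof -
  have "integrable lborel (\<lambda>t. A * exp (- (\<kappa> * s)) * (indicator {0<..} t * ((1 + 0 / sqrt t) * exp (rate \<kappa> * t))) +
     B * (indicator {0<..} t * ((1 + 0 / sqrt t) * exp (rate 0 * t))))"
    by (intro Bochner_Integration.integrable_add integrable_mult_right integrable_exp_over_sqrt assms rate0)
  then show ?thesis by (simp add: envelope_def algebra_simps)
qed

text \<open>The negative rates give decay at infinity, and the singularity \<open>1 / sqrt t\<close>
  is integrable at zero.\<close>

lemma integrable_slope_envelope:
  assumes "rate \<kappa> < 0"
  shows "integrable lborel (\<lambda>t. indicator {0<..} t * (slope \<kappa> t * envelope \<kappa> A B s t))"
proof -
  have "integrable lborel (\<lambda>t. A * exp (- (\<kappa> * s)) *
       (indicator {0<..} t * ((\<bar>\<kappa>\<bar> + 2 * \<bar>\<rho>\<bar> + exp 1 / \<bar>a\<bar> / sqrt t) * exp (rate \<kappa> * t))) +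
     B * (indicator {0<..} t * ((\<bar>\<kappa>\<bar> + 2 * \<bar>\<rho>\<bar> + exp 1 / \<bar>a\<bar> / sqrt t) * exp (rate 0 * t))))"
    by (intro Bochner_Integration.integrable_add integrable_mult_right integrable_exp_over_sqrt assms rate0)
  also have "(\<lambda>t. A * exp (- (\<kappa> * s)) *
       (indicator {0<..} t * ((\<bar>\<kappa>\<bar> + 2 * \<bar>\<rho>\<bar> + exp 1 / \<bar>a\<bar> / sqrt t) * exp (rate \<kappa> * t))) +
     B * (indicator {0<..} t * ((\<bar>\<kappa>\<bar> + 2 * \<bar>\<rho>\<bar> + exp 1 / \<bar>a\<bar> / sqrt t) * exp (rate 0 * t)))) =
     (\<lambda>t. indicator {0<..} t * (slope \<kappa> t * envelope \<kappa> A B s t))"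
    unfolding envelope_def slope_def[symmetric] by (rule ext) (simp only: algebra_simps)
  finally show ?thesis .
qed

lemma integral_envelope:
  assumes "rate \<kappa> < 0"
  shows "(LINT t|lborel. indicator {0<..} t * envelope \<kappa> A B s t) =
    A * exp (- (\<kappa> * s)) / (- rate \<kappa>) + B / (- rate 0)"
proof -
  have int: "integrable lborel (\<lambda>t. indicator {0<..} t * exp (c * t))" if "c < 0" for c :: real
    using integrable_exp_over_sqrt[OF that, of 1 0] by simp
  have "(LINT t|lborel. indicator {0<..} t * envelope \<kappa> A B s t) =
     (LINT t|lborel. A * exp (- (\<kappa> * s)) * (indicator {0<..} t * exp (rate \<kappa> * t)) +
        B * (indicator {0<..} t * exp (rate 0 * t)))"
    by (intro Bochner_Integration.integral_cong) (auto simp: envelope_def algebra_simps)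
  also have "\<dots> = A * exp (- (\<kappa> * s)) * (- 1 / rate \<kappa>) + B * (- 1 / rate 0)"
    using int[OF assms] int[OF rate0] by (simp add: integral_exp_Ioi[OF assms] integral_exp_Ioi[OF rate0])
  finally show ?thesis by simp
qed

lemma envelope_antimono:
  assumes "0 \<le> \<kappa>" "0 \<le> A" "s' \<le> s"
  shows "envelope \<kappa> A B s t \<le> envelope \<kappa> A B s' t"
  using assms unfolding envelope_def by (intro add_right_mono mult_right_mono mult_left_mono) (auto intro: mult_left_mono)

lemma time_heat_abs_le:
  assumes "exp_dominated \<kappa> A B g" "J \<subseteq> {0<..}"
  shows "\<bar>indicator J t * heat t g s\<bar> \<le> indicator {0<..} t * envelope \<kappa> A B s t"
  using heat_abs_le[OF assms(1), of t s] assms(2) order_trans[OF abs_ge_zero heat_abs_le[OF assms(1), of t s]]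
  by (auto simp: indicator_def)

lemma time_heat_deriv_abs_le:
  assumes "exp_dominated \<kappa> A B g" "J \<subseteq> {0<..}"
  shows "\<bar>indicator J t * heat_deriv t g s\<bar> \<le> indicator {0<..} t * (slope \<kappa> t * envelope \<kappa> A B s t)"
  using heat_deriv_abs_le[OF assms(1), of t s] assms(2) order_trans[OF abs_ge_zero heat_deriv_abs_le[OF assms(1), of t s]]
  by (auto simp: indicator_def)

lemma time_heat_integrable:
  assumes g: "exp_dominated \<kappa> A B g" and J: "J \<subseteq> {0<..}" "J \<in> sets borel" and \<kappa>: "rate \<kappa> < 0"
  shows "integrable lborel (\<lambda>t. indicator J t * heat t g s)"
proof (rule Bochner_Integration.integrable_bound[OF integrable_envelope[OF \<kappa>]])
  show "(\<lambda>t. indicator J t * heat t g s) \<in> borel_measurable lborel"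
    using heat_measurable[OF g] J(2) by measurable
  show "AE t in lborel. norm (indicator J t * heat t g s) \<le> norm (indicator {0<..} t * envelope \<kappa> A B s t)"
    unfolding real_norm_def by (intro AE_I2 order_trans[OF time_heat_abs_le[OF g J(1)] abs_ge_self])
qed

text \<open>The majorant is taken at \<open>s0 - 1\<close>, the left end of the unit ball, because
  the envelope decreases in \<open>s\<close> for nonnegative \<kappa>.\<close>

lemma has_real_derivative_time_heat:
  assumes g: "exp_dominated \<kappa> A B g" and J: "J \<subseteq> {0<..}" "J \<in> sets borel" and \<kappa>: "rate \<kappa> < 0" "0 \<le> \<kappa>"
  shows "(time_heat J g has_real_derivative time_heat_deriv J g s0) (at s0)"
  unfolding time_heat_def[abs_def] time_heat_deriv_def
proof (rule has_real_derivative_integral[where d = 1 and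
      w = "\<lambda>t. indicator {0<..} t * (slope \<kappa> t * envelope \<kappa> A B (s0 - 1) t)"])
  have A: "0 \<le> A" using g by (auto simp: exp_dominated_def)
  show "((\<lambda>s. indicator J t * heat t g s) has_real_derivative indicator J t * heat_deriv t g s) (at s)" for s t
    using J(1) has_real_derivative_heat[OF g, of t s] by (auto simp: indicator_def)
  show "(\<lambda>t. indicator J t * heat_deriv t g s0) \<in> borel_measurable lborel"
    using heat_measurable[OF g] J(2) by measurable
  show "\<bar>indicator J t * heat_deriv t g s\<bar> \<le> indicator {0<..} t * (slope \<kappa> t * envelope \<kappa> A B (s0 - 1) t)"
    if "s \<in> ball s0 1" for s t
    using that A \<kappa>(2) slope_nonneg[of t \<kappa>]
    by (intro order_trans[OF time_heat_deriv_abs_le[OF g J(1)]])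
      (auto simp: indicator_def dist_real_def intro!: mult_left_mono envelope_antimono)
qed (use integrable_slope_envelope[OF \<kappa>(1)] time_heat_integrable[OF g J \<kappa>(1)] in auto)

lemma indicator_horizon_tendsto:
  fixes X :: "nat \<Rightarrow> real"
  assumes "filterlim X at_top sequentially"
  shows "(\<lambda>n. indicator {0<..<X n} t :: real) \<longlonglongrightarrow> indicator {0<..} t"
proof (rule tendsto_eventually)
  have "\<forall>\<^sub>F n in sequentially. t < X n" using assms unfolding filterlim_at_top_dense by blast
  then show "\<forall>\<^sub>F n in sequentially. indicator {0<..<X n} t = (indicator {0<..} t :: real)"
    by eventually_elim (auto simp: indicator_def)
qed

lemma time_heat_tendsto:
  assumes g: "exp_dominated \<kappa> A B g" and \<kappa>: "rate \<kappa> < 0" and X: "filterlim X at_top sequentially"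
  shows "(\<lambda>n. time_heat {0<..<X n} g s) \<longlonglongrightarrow> time_heat {0<..} g s"
  unfolding time_heat_def
proof (rule integral_dominated_convergence[where w = "\<lambda>t. indicator {0<..} t * envelope \<kappa> A B s t"])
  show "AE t in lborel. (\<lambda>n. indicator {0<..<X n} t * heat t g s) \<longlonglongrightarrow> indicator {0<..} t * heat t g s"
    by (intro AE_I2 tendsto_intros indicator_horizon_tendsto X)
  show "AE t in lborel. norm (indicator {0<..<X n} t * heat t g s) \<le> indicator {0<..} t * envelope \<kappa> A B s t" for n
    unfolding real_norm_def by (intro AE_I2 time_heat_abs_le[OF g]) auto
  note [measurable] = heat_measurable[OF g]
  show "(\<lambda>t. indicator {0<..<X n} t * heat t g s) \<in> borel_measurable lborel" for n by measurable
  show "(\<lambda>t. indicator {0<..} t * heat t g s) \<in> borel_measurable lborel" by measurable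
qed (rule integrable_envelope[OF \<kappa>])

text \<open>Horizon and evaluation point move together; the common lower bound \<open>m\<close> of
  the points provides one integrable majorant.\<close>

lemma time_heat_deriv_tendsto:
  assumes g: "exp_dominated \<kappa> A B g" and \<kappa>: "rate \<kappa> < 0" "0 \<le> \<kappa>" and X: "filterlim X at_top sequentially"
    and S: "S \<longlonglongrightarrow> s" and m: "\<And>n. m \<le> S n"
  shows "(\<lambda>n. time_heat_deriv {0<..<X n} g (S n)) \<longlonglongrightarrow> time_heat_deriv {0<..} g s"
  unfolding time_heat_deriv_def
proof (rule integral_dominated_convergence[where w = "\<lambda>t. indicator {0<..} t * (slope \<kappa> t * envelope \<kappa> A B m t)"])
  have A: "0 \<le> A" using g by (auto simp: exp_dominated_def)
  show "AE t in lborel. (\<lambda>n. indicator {0<..<X n} t * heat_deriv t g (S n)) \<longlonglongrightarrow> indicator {0<..} t * heat_deriv t g s"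
    by (intro AE_I2 tendsto_intros indicator_horizon_tendsto X heat_deriv_tendsto[OF g \<kappa>(2) S])
  have "\<bar>indicator {0<..<X n} t * heat_deriv t g (S n)\<bar> \<le> indicator {0<..} t * (slope \<kappa> t * envelope \<kappa> A B m t)" for n t
  proof (rule order_trans[OF time_heat_deriv_abs_le[OF g]])
    show "indicator {0<..} t * (slope \<kappa> t * envelope \<kappa> A B (S n) t) \<le> indicator {0<..} t * (slope \<kappa> t * envelope \<kappa> A B m t)"
      using m[of n] A \<kappa>(2) slope_nonneg[of t \<kappa>]
      by (auto simp: indicator_def intro!: mult_left_mono envelope_antimono)
  qed auto
  then show "AE t in lborel. norm (indicator {0<..<X n} t * heat_deriv t g (S n)) \<le>
      indicator {0<..} t * (slope \<kappa> t * envelope \<kappa> A B m t)" for n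
    unfolding real_norm_def by (intro AE_I2)
  note [measurable] = heat_measurable[OF g]
  show "(\<lambda>t. indicator {0<..<X n} t * heat_deriv t g (S n)) \<in> borel_measurable lborel" for n by measurable
  show "(\<lambda>t. indicator {0<..} t * heat_deriv t g s) \<in> borel_measurable lborel" by measurable
qed (rule integrable_slope_envelope[OF \<kappa>(1)])

text \<open>The integrands are ordered since \<open>g\<close> is nonincreasing, and strictly so on
  an open set. It is nonempty because the substitution \<open>u = s + b * \<eta>\<close> carries the
  point of strict decrease of \<open>g\<close> into it.\<close>

lemma heat_strict_antimono:
  assumes g: "marginal \<kappa> g" "0 \<le> \<kappa>" and t: "t > 0" and s: "s < s'"
  shows "heat t g s' < heat t g s"
proof -
  obtain C where C: "exp_dominated \<kappa> C 1 g" using marginal_dominated[OF g, of 1] by auto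
  define b where "b = a * sqrt t"
  have b: "b \<noteq> 0" using a_nz t by (simp add: b_def)
  have anti: "antimono g" and cont: "continuous_on UNIV g" using g by (auto simp: marginal_def)
  have "(LINT \<eta>|lborel. gauss_kernel (- (\<rho> * b)) \<eta> * g (s' + b * \<eta>)) <
      (LINT \<eta>|lborel. gauss_kernel (- (\<rho> * b)) \<eta> * g (s + b * \<eta>))"
  proof (rule integral_strict_mono_on_open[OF heat_integrable[OF C] heat_integrable[OF C]])
    show "open {\<eta>. g (s' + b * \<eta>) < g (s + b * \<eta>)}"
      by (intro open_Collect_less continuous_on_compose2[OF cont] continuous_intros) auto
    obtain u where u: "g (u + (s' - s)) < g u" using marginal_strict_somewhere[OF g(1), of "s' - s"] s by auto
    have "s + b * ((u - s) / b) = u" "s' + b * ((u - s) / b) = u + (s' - s)" using b by auto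
    with u have "(u - s) / b \<in> {\<eta>. g (s' + b * \<eta>) < g (s + b * \<eta>)}" by (simp only: mem_Collect_eq)
    then show "{\<eta>. g (s' + b * \<eta>) < g (s + b * \<eta>)} \<noteq> {}" by blast
    show "gauss_kernel (- (\<rho> * b)) \<eta> * g (s' + b * \<eta>) \<le> gauss_kernel (- (\<rho> * b)) \<eta> * g (s + b * \<eta>)" for \<eta>
      using s by (intro mult_left_mono antimonoD[OF anti] less_imp_le[OF gauss_kernel_pos]) auto
    show "gauss_kernel (- (\<rho> * b)) \<eta> * g (s' + b * \<eta>) < gauss_kernel (- (\<rho> * b)) \<eta> * g (s + b * \<eta>)"
      if "\<eta> \<in> {\<eta>. g (s' + b * \<eta>) < g (s + b * \<eta>)}" for \<eta>
      using that by (intro mult_strict_left_mono gauss_kernel_pos) auto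
  qed
  then show ?thesis unfolding heat_def b_def by (intro mult_strict_left_mono) auto
qed

lemma time_heat_antimono:
  assumes g: "marginal \<kappa> g" "0 \<le> \<kappa>" "rate \<kappa> < 0" and J: "J \<subseteq> {0<..}" "J \<in> sets borel" and s: "s < s'"
  shows "time_heat J g s' \<le> time_heat J g s"
proof -
  obtain C where C: "exp_dominated \<kappa> C 1 g" using marginal_dominated[OF g(1,2), of 1] by auto
  show ?thesis
    unfolding time_heat_def using heat_strict_antimono[OF g(1,2) _ s] J(1)
    by (intro integral_mono time_heat_integrable[OF C J g(3)]) (auto simp: indicator_def less_imp_le)
qed

text \<open>Strictness is essential here: at a finite horizon the flow of \<open>g1\<close> supplies
  it, but the limit of that flow is zero when its rate is negative.\<close>

lemma time_heat_strict_antimono: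
  assumes g: "marginal \<kappa> g" "0 \<le> \<kappa>" "rate \<kappa> < 0" and s: "s < s'"
  shows "time_heat {0<..} g s' < time_heat {0<..} g s"
proof -
  obtain C where C: "exp_dominated \<kappa> C 1 g" using marginal_dominated[OF g(1,2), of 1] by auto
  show ?thesis
    unfolding time_heat_def using heat_strict_antimono[OF g(1,2) _ s]
    by (intro integral_strict_mono_on_open[where A = "{0<..}"] time_heat_integrable[OF C _ _ g(3)])
      (auto simp: indicator_def less_imp_le)
qed

lemma time_heat_upper:
  assumes g: "exp_dominated \<kappa> A B g" and \<kappa>: "rate \<kappa> < 0"
  shows "time_heat {0<..} g s \<le> A * exp (- (\<kappa> * s)) / (- rate \<kappa>) + B / (- rate 0)"
  unfolding time_heat_def integral_envelope[OF \<kappa>, symmetric]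
  by (intro integral_mono integrable_envelope time_heat_integrable[OF g] \<kappa>
      order_trans[OF abs_ge_self time_heat_abs_le[OF g]]) auto

lemma time_heat_exp:
  assumes "rate \<kappa> < 0"
  shows "time_heat {0<..} (\<lambda>u. exp (- (\<kappa> * u))) s = exp (- (\<kappa> * s)) / (- rate \<kappa>)"
proof -
  have "time_heat {0<..} (\<lambda>u. exp (- (\<kappa> * u))) s = (LINT t|lborel. indicator {0<..} t * envelope \<kappa> 1 0 s t)"
    unfolding time_heat_def by (intro Bochner_Integration.integral_cong) (auto simp: indicator_def heat_exp envelope_def)
  then show ?thesis by (simp add: integral_envelope[OF assms])
qed

text \<open>The upper bound for the flow of \<open>exp (- (\<kappa> * u)) - g u\<close> is
  subtracted from the exact value for the exponential. If \<open>A < 1\<close>, the lower bound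
  still grows like the exponential as \<open>s\<close> decreases.\<close>

lemma time_heat_lower:
  assumes g: "exp_dominated \<kappa> A' B' g" and d: "exp_dominated \<kappa> A B (\<lambda>u. g u - exp (- (\<kappa> * u)))" and \<kappa>: "rate \<kappa> < 0"
  shows "(1 - A) * exp (- (\<kappa> * s)) / (- rate \<kappa>) - B / (- rate 0) \<le> time_heat {0<..} g s"
proof -
  have eq: "indicator {0<..} t * heat t (\<lambda>u. exp (- (\<kappa> * u)) - g u) s =
      indicator {0<..} t * heat t (\<lambda>u. exp (- (\<kappa> * u))) s - indicator {0<..} t * heat t g s" for t
    by (simp add: heat_diff[OF exp_dominated_exp g] right_diff_distrib)
  have d': "exp_dominated \<kappa> A B (\<lambda>u. exp (- (\<kappa> * u)) - g u)"
    using d g unfolding exp_dominated_def by (auto simp: abs_minus_commute intro!: continuous_intros)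
  have "time_heat {0<..} (\<lambda>u. exp (- (\<kappa> * u)) - g u) s =
      time_heat {0<..} (\<lambda>u. exp (- (\<kappa> * u))) s - time_heat {0<..} g s"
    unfolding time_heat_def eq
    by (intro Bochner_Integration.integral_diff time_heat_integrable[OF exp_dominated_exp]
        time_heat_integrable[OF g] \<kappa>) auto
  with time_heat_upper[OF d' \<kappa>, of s] time_heat_exp[OF \<kappa>, of s] show ?thesis
    by (simp add: algebra_simps diff_divide_distrib)
qed

text \<open>The constant \<open>C\<close> may grow as \<epsilon> shrinks, but for each fixed
  \<epsilon> it is multiplied by a factor that tends to zero. Restricting to
  \<open>X n \<ge> 1\<close> stays away from the singularity at time zero.\<close>

lemma error_tendsto_0:
  fixes D :: "nat \<Rightarrow> real"
  assumes X: "filterlim X at_top sequentially" and "K > 0" "E > 0"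
    and D: "\<And>\<epsilon>. \<epsilon> > 0 \<Longrightarrow> \<exists>C. \<forall>n. X n \<ge> 1 \<longrightarrow> \<bar>D n\<bar> \<le> K * (\<epsilon> * E + C * exp (rate 0 * X n))"
  shows "D \<longlonglongrightarrow> 0"
proof (rule tendstoI)
  fix e :: real assume e: "e > 0"
  \<comment> \<open>This choice of \<epsilon> makes the first error term equal to
    \<open>e / 2\<close>.\<close>
  obtain C where C: "\<And>n. X n \<ge> 1 \<Longrightarrow> \<bar>D n\<bar> \<le> K * (e / (2 * K * E) * E + C * exp (rate 0 * X n))"
    using D[of "e / (2 * K * E)"] e assms by auto
  have "(\<lambda>n. K * C * exp (rate 0 * X n)) \<longlonglongrightarrow> K * C * 0"
    using rate0 X
    by (intro tendsto_intros filterlim_compose[OF exp_at_bot] filterlim_tendsto_neg_mult_at_bot[OF tendsto_const])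
  then have "\<forall>\<^sub>F n in sequentially. K * C * exp (rate 0 * X n) < e / 2"
    using e by (intro order_tendstoD) auto
  moreover have "\<forall>\<^sub>F n in sequentially. 1 \<le> X n" using X by (simp add: filterlim_at_top)
  ultimately show "\<forall>\<^sub>F n in sequentially. dist (D n) 0 < e"
  proof eventually_elim
    case (elim n)
    have "K * (e / (2 * K * E) * E + C * exp (rate 0 * X n)) = e / 2 + K * C * exp (rate 0 * X n)"
      using assms(2,3) by (simp add: field_simps)
    with C[OF elim(2)] elim(1) show ?case by simp
  qed
qed

lemma exp_rate_tendsto:
  assumes "rate \<kappa> \<le> 0" "filterlim X at_top sequentially"
  shows "(\<lambda>n. exp (rate \<kappa> * X n)) \<longlonglongrightarrow> of_bool (rate \<kappa> = 0)"
proof (cases "rate \<kappa> = 0")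
  case False
  with assms show ?thesis
    by (auto intro!: filterlim_compose[OF exp_at_bot] filterlim_tendsto_neg_mult_at_bot[OF tendsto_const])
qed simp

text \<open>Split \<open>g\<close> into the exponential, whose flow is explicit, and a remainder
  with arbitrarily small exponential coefficient. The limit of the explicit part is nonzero only at
  the critical rate zero.\<close>

lemma marginal_heat_tendsto:
  assumes g: "marginal \<kappa> g" "0 \<le> \<kappa>" "rate \<kappa> \<le> 0" and X: "filterlim X at_top sequentially"
    and S: "S \<longlonglongrightarrow> s" and m: "\<And>n. m \<le> S n"
  shows "(\<lambda>n. heat (X n) g (S n)) \<longlonglongrightarrow> of_bool (rate \<kappa> = 0) * exp (- (\<kappa> * s))"
    and "(\<lambda>n. heat_deriv (X n) g (S n)) \<longlonglongrightarrow> - \<kappa> * of_bool (rate \<kappa> = 0) * exp (- (\<kappa> * s))"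
proof -
  obtain C where C: "exp_dominated \<kappa> C 1 g" using marginal_dominated[OF g(1,2), of 1] by auto
  let ?d = "\<lambda>u. g u - exp (- (\<kappa> * u))"
  define E where "E = exp (- (\<kappa> * m))"
  \<comment> \<open>\<open>slope\<close> decreases in time, so its value at 1 bounds it whenever
    \<open>X n \<ge> 1\<close>.\<close>
  define K where "K = slope \<kappa> 1"
  have K: "K > 0" using a_nz by (simp add: K_def slope_def add_nonneg_pos)
  have env: "envelope \<kappa> \<epsilon> B (S n) (X n) \<le> \<epsilon> * E + B * exp (rate 0 * X n)"
    if "\<epsilon> > 0" "X n \<ge> 1" for \<epsilon> B n
  proof -
    have "exp (- (\<kappa> * S n)) * exp (rate \<kappa> * X n) \<le> E * 1"
      unfolding E_def using m[of n] g(2,3) that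
      by (intro mult_mono) (auto intro: mult_left_mono mult_nonpos_nonneg)
    then have "\<epsilon> * (exp (- (\<kappa> * S n)) * exp (rate \<kappa> * X n)) \<le> \<epsilon> * E" using that by simp
    then show ?thesis by (simp add: envelope_def mult.assoc)
  qed
  have "(\<lambda>n. heat (X n) ?d (S n)) \<longlonglongrightarrow> 0"
  proof (rule error_tendsto_0[OF X, of 1 E])
    fix \<epsilon> :: real assume e: "\<epsilon> > 0"
    obtain B where B: "exp_dominated \<kappa> \<epsilon> B ?d" using marginal_near_exp[OF g(1,2) e] by auto
    show "\<exists>C. \<forall>n. X n \<ge> 1 \<longrightarrow> \<bar>heat (X n) ?d (S n)\<bar> \<le> 1 * (\<epsilon> * E + C * exp (rate 0 * X n))"
      using env[OF e] by (intro exI[of _ B]) (auto intro: order_trans[OF heat_abs_le[OF B]])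
  qed (auto simp: E_def)
  moreover have "(\<lambda>n. exp (- (\<kappa> * S n)) * exp (rate \<kappa> * X n)) \<longlonglongrightarrow> exp (- (\<kappa> * s)) * of_bool (rate \<kappa> = 0)"
    by (intro tendsto_intros S exp_rate_tendsto[OF g(3) X])
  ultimately have "(\<lambda>n. heat (X n) ?d (S n) + exp (- (\<kappa> * S n)) * exp (rate \<kappa> * X n)) \<longlonglongrightarrow>
      0 + exp (- (\<kappa> * s)) * of_bool (rate \<kappa> = 0)" by (rule tendsto_add)
  moreover have "\<forall>\<^sub>F n in sequentially. heat (X n) ?d (S n) + exp (- (\<kappa> * S n)) * exp (rate \<kappa> * X n) = heat (X n) g (S n)"
    using X[unfolded filterlim_at_top, rule_format, of 0]
    by eventually_elim (simp add: heat_diff[OF C exp_dominated_exp] heat_exp)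
  ultimately show "(\<lambda>n. heat (X n) g (S n)) \<longlonglongrightarrow> of_bool (rate \<kappa> = 0) * exp (- (\<kappa> * s))"
    by (auto dest: Lim_transform_eventually simp: mult.commute)
  have "(\<lambda>n. heat_deriv (X n) ?d (S n)) \<longlonglongrightarrow> 0"
  proof (rule error_tendsto_0[OF X K, of E])
    fix \<epsilon> :: real assume e: "\<epsilon> > 0"
    obtain B where B: "exp_dominated \<kappa> \<epsilon> B ?d" using marginal_near_exp[OF g(1,2) e] by auto
    have "\<bar>heat_deriv (X n) ?d (S n)\<bar> \<le> K * (\<epsilon> * E + B * exp (rate 0 * X n))" if "X n \<ge> 1" for n
    proof -
      have "\<bar>heat_deriv (X n) ?d (S n)\<bar> \<le> slope \<kappa> (X n) * envelope \<kappa> \<epsilon> B (S n) (X n)"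
        using that by (intro heat_deriv_abs_le[OF B]) auto
      also have "\<dots> \<le> K * (\<epsilon> * E + B * exp (rate 0 * X n))"
      proof (rule mult_mono)
        show "slope \<kappa> (X n) \<le> K"
          unfolding K_def slope_def using that a_nz by (intro add_left_mono divide_left_mono) auto
        show "0 \<le> envelope \<kappa> \<epsilon> B (S n) (X n)"
          using B e by (auto simp: envelope_def exp_dominated_def)
      qed (use env[OF e that] K in auto)
      finally show ?thesis .
    qed
    then show "\<exists>C. \<forall>n. X n \<ge> 1 \<longrightarrow> \<bar>heat_deriv (X n) ?d (S n)\<bar> \<le> K * (\<epsilon> * E + C * exp (rate 0 * X n))" by auto
  qed (auto simp: E_def)
  moreover have "(\<lambda>n. - \<kappa> * exp (- (\<kappa> * S n)) * exp (rate \<kappa> * X n)) \<longlonglongrightarrow> - \<kappa> * exp (- (\<kappa> * s)) * of_bool (rate \<kappa> = 0)"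
    by (intro tendsto_intros S exp_rate_tendsto[OF g(3) X])
  ultimately have "(\<lambda>n. heat_deriv (X n) ?d (S n) + - \<kappa> * exp (- (\<kappa> * S n)) * exp (rate \<kappa> * X n)) \<longlonglongrightarrow>
      0 + - \<kappa> * exp (- (\<kappa> * s)) * of_bool (rate \<kappa> = 0)" by (rule tendsto_add)
  moreover have "\<forall>\<^sub>F n in sequentially. heat_deriv (X n) ?d (S n) + - \<kappa> * exp (- (\<kappa> * S n)) * exp (rate \<kappa> * X n) = heat_deriv (X n) g (S n)"
    using X[unfolded filterlim_at_top, rule_format, of 1]
    by eventually_elim (simp add: heat_deriv_diff[OF C exp_dominated_exp] heat_deriv_exp)
  ultimately show "(\<lambda>n. heat_deriv (X n) g (S n)) \<longlonglongrightarrow> - \<kappa> * of_bool (rate \<kappa> = 0) * exp (- (\<kappa> * s))"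
    by (auto dest: Lim_transform_eventually simp: mult.commute mult.left_commute)
qed

end

section \<open>Limiting wealth\<close>

text \<open>In the market \<open>\<kappa>1 = 1 - q1\<close> and \<open>\<kappa>2 = 1 - q2\<close>.
  The weak inequality for the first rate admits the critical case \<open>q1 = q_star\<close>; the
  strict second one makes the accumulated flow converge.\<close>

locale consumption_model = transient_heat +
  fixes \<kappa>1 \<kappa>2 :: real and g1 g2 :: "real \<Rightarrow> real"
  assumes g1: "marginal \<kappa>1 g1" "0 < \<kappa>1" "rate \<kappa>1 \<le> 0"
    and g2: "marginal \<kappa>2 g2" "0 < \<kappa>2" "rate \<kappa>2 < 0"
begin

text \<open>In the market this is \<open>- v_y\<close> at the point \<open>exp s\<close>.\<close>

definition wealth :: "real \<Rightarrow> real \<Rightarrow> real" where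
  "wealth t s = heat t g1 s + time_heat {0<..<t} g2 s"

definition wealth_deriv :: "real \<Rightarrow> real \<Rightarrow> real" where
  "wealth_deriv t s = heat_deriv t g1 s + time_heat_deriv {0<..<t} g2 s"

text \<open>In the market this is the right-hand side of the equation for \<open>Y\<close>, at
  \<open>Y = exp s\<close>.\<close>

definition limit_wealth :: "real \<Rightarrow> real" where
  "limit_wealth s = of_bool (rate \<kappa>1 = 0) * exp (- (\<kappa>1 * s)) + time_heat {0<..} g2 s"

definition limit_wealth_deriv :: "real \<Rightarrow> real" where
  "limit_wealth_deriv s = - \<kappa>1 * of_bool (rate \<kappa>1 = 0) * exp (- (\<kappa>1 * s)) + time_heat_deriv {0<..} g2 s"

lemma dominated1: "\<exists>C. exp_dominated \<kappa>1 C 1 g1" and dominated2: "\<exists>C. exp_dominated \<kappa>2 C 1 g2"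
  using marginal_dominated[OF g1(1), of 1] marginal_dominated[OF g2(1), of 1] g1(2) g2(2) by auto

lemma has_real_derivative_accumulated:
  assumes "J \<subseteq> {0<..}" "J \<in> sets borel"
  shows "(time_heat J g2 has_real_derivative time_heat_deriv J g2 s) (at s)"
  using dominated2 has_real_derivative_time_heat[OF _ assms g2(3)] g2(2) by auto

lemma has_real_derivative_wealth:
  assumes "t > 0"
  shows "(wealth t has_real_derivative wealth_deriv t s) (at s)"
  using dominated1 unfolding wealth_def[abs_def] wealth_deriv_def
  by (auto intro!: DERIV_add has_real_derivative_heat has_real_derivative_accumulated assms)

lemma has_real_derivative_limit_wealth: "(limit_wealth has_real_derivative limit_wealth_deriv s) (at s)"
  unfolding limit_wealth_def[abs_def] limit_wealth_deriv_def
  by (intro DERIV_add has_real_derivative_accumulated) (auto intro!: derivative_eq_intros)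

lemma wealth_strict_antimono:
  assumes "t > 0" "s < s'"
  shows "wealth t s' < wealth t s"
  unfolding wealth_def using g1(2) g2(2)
  by (intro add_less_le_mono heat_strict_antimono[OF g1(1) _ assms] time_heat_antimono[OF g2(1) _ g2(3) _ _ assms(2)]) auto

lemma limit_wealth_strict_antimono:
  assumes "s < s'"
  shows "limit_wealth s' < limit_wealth s"
  unfolding limit_wealth_def using g1(2) g2(2) assms
  by (intro add_le_less_mono time_heat_strict_antimono[OF g2(1) _ g2(3) assms] mult_left_mono) auto

lemma wealth_tendsto: "((\<lambda>t. wealth t s) \<longlongrightarrow> limit_wealth s) at_top"
proof (rule tendsto_at_topI_sequentially)
  fix X :: "nat \<Rightarrow> real" assume X: "filterlim X at_top sequentially"
  obtain C where C: "exp_dominated \<kappa>2 C 1 g2" using dominated2 by auto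
  show "(\<lambda>n. wealth (X n) s) \<longlonglongrightarrow> limit_wealth s"
    unfolding wealth_def limit_wealth_def using g1(2)
    by (intro tendsto_add marginal_heat_tendsto(1)[OF g1(1) _ g1(3) X tendsto_const order_refl]
        time_heat_tendsto[OF C g2(3) X]) auto
qed

text \<open>The evaluation point varies because the optimal dual point itself depends on the
  horizon.\<close>

lemma wealth_deriv_tendsto:
  assumes S: "(S \<longlongrightarrow> s) at_top"
  shows "((\<lambda>t. wealth_deriv t (S t)) \<longlongrightarrow> limit_wealth_deriv s) at_top"
proof (rule tendsto_at_topI_sequentially)
  fix X :: "nat \<Rightarrow> real" assume X: "filterlim X at_top sequentially"
  obtain C where C: "exp_dominated \<kappa>2 C 1 g2" using dominated2 by auto
  have SX: "(\<lambda>n. S (X n)) \<longlonglongrightarrow> s" using filterlim_compose[OF S X] .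
  then have "Bseq (\<lambda>n. S (X n))" by (intro convergent_imp_Bseq) (auto simp: convergent_def)
  then obtain M where M: "\<And>n. \<bar>S (X n)\<bar> \<le> M" by (auto simp: Bseq_def)
  then have m: "- M \<le> S (X n)" for n using abs_le_D2[OF M[of n]] by linarith
  show "(\<lambda>n. wealth_deriv (X n) (S (X n))) \<longlonglongrightarrow> limit_wealth_deriv s"
    unfolding wealth_deriv_def limit_wealth_deriv_def using g1(2) g2(2)
    by (intro tendsto_add marginal_heat_tendsto(2)[OF g1(1) _ g1(3) X SX m]
        time_heat_deriv_tendsto[OF C g2(3) _ X SX m]) auto
qed

text \<open>The strictly decreasing limit separates the level from its values at
  \<open>s0 - d\<close> and \<open>s0 + d\<close>. Pointwise convergence at these two points alone
  traps a root between them for large \<open>t\<close>.\<close>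

lemma eventually_wealth_root:
  assumes "e > 0"
  shows "\<forall>\<^sub>F t in at_top. t > 0 \<and> (\<exists>s. \<bar>s - s0\<bar> < e \<and> wealth t s = limit_wealth s0)"
proof -
  define d where "d = e / 2"
  have d: "0 < d" "d < e" using assms by (auto simp: d_def)
  have "\<forall>\<^sub>F t in at_top. limit_wealth s0 < wealth t (s0 - d)"
    using d by (intro order_tendstoD(1)[OF wealth_tendsto] limit_wealth_strict_antimono) auto
  moreover have "\<forall>\<^sub>F t in at_top. wealth t (s0 + d) < limit_wealth s0"
    using d by (intro order_tendstoD(2)[OF wealth_tendsto] limit_wealth_strict_antimono) auto
  ultimately show ?thesis
    using eventually_gt_at_top[of 0]
  proof eventually_elim
    case (elim t)
    have "\<exists>s\<ge>s0 - d. s \<le> s0 + d \<and> wealth t s = limit_wealth s0"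
      using elim d has_real_derivative_wealth[OF elim(3)] by (intro IVT2) (auto intro: DERIV_isCont)
    with d elim(3) show ?case by force
  qed
qed

text \<open>The intermediate value theorem between a point where the upper bound is below
  \<open>x\<close> and one where the lower bound exceeds \<open>x\<close>.\<close>

lemma limit_wealth_surj:
  assumes x: "x > 0"
  shows "\<exists>s. limit_wealth s = x"
proof -
  \<comment> \<open>With this \<epsilon> the constant part contributes exactly \<open>x / 4\<close>
    to the upper bound; the exponential parts are made smaller than another
    \<open>x / 4\<close>.\<close>
  define \<epsilon> where "\<epsilon> = x * (- rate 0) / 4"
  have e: "\<epsilon> > 0" using x rate0 by (auto simp: \<epsilon>_def intro!: mult_pos_pos mult_pos_neg)
  obtain C where C: "exp_dominated \<kappa>2 C \<epsilon> g2" using marginal_dominated[OF g2(1) _ e] g2(2) by auto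
  \<comment> \<open>Relative error \<open>1 / 2\<close> leaves half of the exponential in the lower
    bound, enough for it to be unbounded as \<open>s\<close> decreases.\<close>
  obtain B where B: "exp_dominated \<kappa>2 (1/2) B (\<lambda>u. g2 u - exp (- (\<kappa>2 * u)))"
    using marginal_near_exp[OF g2(1), of "1/2"] g2(2) by auto
  have lim0: "((\<lambda>s. exp (- (\<kappa> * s))) \<longlongrightarrow> 0) at_top" if "\<kappa> > 0" for \<kappa> :: real
    using that filterlim_tendsto_neg_mult_at_bot[OF tendsto_const _ filterlim_ident, of "- \<kappa>"]
    by (intro filterlim_compose[OF exp_at_bot]) auto
  have "((\<lambda>s. of_bool (rate \<kappa>1 = 0) * exp (- (\<kappa>1 * s)) + C * exp (- (\<kappa>2 * s)) / (- rate \<kappa>2)) \<longlongrightarrow>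
      of_bool (rate \<kappa>1 = 0) * 0 + C * 0 / (- rate \<kappa>2)) at_top"
    using g2(3) by (intro tendsto_intros lim0 g1(2) g2(2)) auto
  then have "\<forall>\<^sub>F s in at_top. of_bool (rate \<kappa>1 = 0) * exp (- (\<kappa>1 * s)) + C * exp (- (\<kappa>2 * s)) / (- rate \<kappa>2) < x / 4"
    using x by (intro order_tendstoD(2)) auto
  then obtain s1 where s1: "of_bool (rate \<kappa>1 = 0) * exp (- (\<kappa>1 * s1)) + C * exp (- (\<kappa>2 * s1)) / (- rate \<kappa>2) < x / 4"
    by (auto simp: eventually_at_top_linorder)
  have "\<epsilon> / (- rate 0) = x / 4" using rate0 by (simp add: \<epsilon>_def)
  with s1 time_heat_upper[OF C g2(3), of s1] x have upper: "limit_wealth s1 < x"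
    unfolding limit_wealth_def by linarith
  have "filterlim (\<lambda>s. (- \<kappa>2) * s) at_top at_bot"
    using g2(2) filterlim_tendsto_pos_mult_at_bot[OF tendsto_const _ filterlim_ident, of \<kappa>2]
    by (simp add: filterlim_uminus_at_top)
  then have "filterlim (\<lambda>s. exp (- (\<kappa>2 * s))) at_top at_bot"
    by (intro filterlim_compose[OF exp_at_top]) simp
  then have "\<forall>\<^sub>F s in at_bot. exp (- (\<kappa>2 * s)) > 2 * (- rate \<kappa>2) * (x + B / (- rate 0))"
    by (auto simp: filterlim_at_top_dense)
  then obtain s2 where s2: "exp (- (\<kappa>2 * s2)) > 2 * (- rate \<kappa>2) * (x + B / (- rate 0))"
    by (auto simp: eventually_at_bot_linorder)
  have "w < (1 - 1 / 2) * E / R" if "2 * R * w < E" "R > 0" for R w E :: real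
    using that by (simp add: field_simps)
  from this[OF s2] have "(1 - 1 / 2) * exp (- (\<kappa>2 * s2)) / (- rate \<kappa>2) > x + B / (- rate 0)"
    using g2(3) by simp
  with time_heat_lower[OF C B g2(3), of s2] have "x < time_heat {0<..} g2 s2" by linarith
  then have lower: "x < limit_wealth s2" unfolding limit_wealth_def by (simp add: add_strict_increasing2)
  have "s2 \<le> s1"
    using upper lower limit_wealth_strict_antimono[of s1 s2] by (cases "s2 \<le> s1") auto
  then show ?thesis
    using IVT2[of limit_wealth s1 x s2] upper lower
      DERIV_isCont[OF has_real_derivative_limit_wealth] by auto
qed

end

section \<open>From utilities to marginal functions\<close>

lemma dual_bdd_above:
  assumes U: "utility_function U" and y: "y > 0"
  shows "bdd_above ((\<lambda>x. U x - x * y) ` {0..})"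
proof -
  obtain C p where C: "C > 0" and p: "0 < p" "p < 1" and le: "\<And>x. x \<ge> 0 \<Longrightarrow> U x \<le> C * (1 + x powr p)"
    using U by (auto simp: utility_function_def)
  \<comment> \<open>\<open>M\<close> is the positive solution of
    \<open>C * x powr p = x * y\<close>; beyond it the linear cost outweighs the sublinear growth of
    \<open>U\<close>.\<close>
  define M where "M = (C / y) powr (1 / (1 - p))"
  have M: "M > 0" using C y by (simp add: M_def)
  have "U x - x * y \<le> C + C * M powr p" if x: "x \<ge> 0" for x
  proof (cases "x \<le> M")
    case True
    then have "C * x powr p \<le> C * M powr p" using x p C by (intro mult_left_mono powr_mono2) auto
    moreover have "0 \<le> x * y" using x y by simp
    ultimately show ?thesis using le[OF x] by (simp add: algebra_simps)
  next
    case False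
    then have "M powr (1 - p) \<le> x powr (1 - p)" using M p by (intro powr_mono2) auto
    then have "C / y \<le> x powr (1 - p)" using p C y by (simp add: M_def powr_powr)
    then have "C * x powr p \<le> (x powr (1 - p) * y) * x powr p"
      using y by (intro mult_right_mono) (auto simp: field_simps)
    also have "\<dots> = x * y" using False M by (simp add: powr_add[symmetric])
    finally have "C * x powr p \<le> x * y" .
    moreover have "0 \<le> C * M powr p" using C by simp
    ultimately show ?thesis using le[OF x] by (simp add: algebra_simps)
  qed
  then show ?thesis by (intro bdd_aboveI2) auto
qed

text \<open>As a supremum of affine functions of \<open>y\<close> with nonpositive slopes,
  \<open>V\<close> is convex and nonincreasing; the choice \<open>x = 0\<close> makes it
  nonnegative. These facts give sign, monotonicity and decay of its derivative.\<close>

lemma marginal_dual_function: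
  assumes U: "utility_function U" and V: "V = dual_function U" and C1: "V C1_differentiable_on {0<..}"
    and q: "((\<lambda>y. deriv V y / y powr (q - 1)) \<longlongrightarrow> -1) (at_right 0)"
  shows "marginal (1 - q) (\<lambda>u. - deriv V (exp u))"
proof -
  obtain D where D: "\<And>x. x > 0 \<Longrightarrow> (V has_vector_derivative D x) (at x)" "continuous_on {0<..} D"
    using C1 by (auto simp: C1_differentiable_on_def)
  then have der: "(V has_real_derivative D x) (at x)" if "x > 0" for x
    using that by (simp add: has_real_derivative_iff_has_vector_derivative)
  have DV: "deriv V x = D x" if "x > 0" for x using der[OF that] by (rule DERIV_imp_deriv)
  have bdd: "bdd_above ((\<lambda>x. U x - x * y) ` {0..})" if "y > 0" for y using dual_bdd_above[OF U that] .
  have U0: "U 0 = 0" using U by (simp add: utility_function_def)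
  have ge: "U x - x * y \<le> V y" if "x \<ge> 0" "y > 0" for x y
    unfolding V dual_function_def using that by (intro cSUP_upper bdd) auto
  have nonneg: "0 \<le> V y" if "y > 0" for y using ge[of 0 y] that U0 by simp
  have mono: "V y' \<le> V y" if "0 < y" "y \<le> y'" for y y'
  proof -
    have "U x - x * y' \<le> V y" if "x \<ge> 0" for x
      using ge[of x y] that \<open>0 < y\<close> mult_left_mono[OF \<open>y \<le> y'\<close> that] by auto
    then show ?thesis unfolding V[THEN fun_cong, of y'] dual_function_def by (intro cSUP_least) auto
  qed
  have conv: "convex_on {0<..} V"
  proof (rule convex_onI)
    fix t x y :: real assume t: "0 < t" "t < 1" and xy: "x \<in> {0<..}" "y \<in> {0<..}"
    have pos: "(1 - t) * x + t * y > 0" using t xy by (auto intro!: add_pos_pos mult_pos_pos)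
    have "U z - z * ((1 - t) * x + t * y) \<le> (1 - t) * V x + t * V y" if "z \<ge> 0" for z
    proof -
      have "U z - z * ((1 - t) * x + t * y) = (1 - t) * (U z - z * x) + t * (U z - z * y)"
        by (simp add: algebra_simps)
      also have "\<dots> \<le> (1 - t) * V x + t * V y"
        using t xy that by (intro add_mono mult_left_mono ge) auto
      finally show ?thesis .
    qed
    then have "V ((1 - t) * x + t * y) \<le> (1 - t) * V x + t * V y"
      unfolding V[THEN fun_cong, of "(1 - t) * x + t * y"] dual_function_def by (intro cSUP_least) auto
    then show "V ((1 - t) *\<^sub>R x + t *\<^sub>R y) \<le> (1 - t) * V x + t * V y" by simp
  qed simp
  have tangent: "V y + D y * (z - y) \<le> V z" if "y > 0" "z > 0" for y z
    using convex_on_imp_above_tangent[OF conv, of y z "D y"] that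
      has_field_derivative_at_within[OF der[OF that(1)]] by (auto simp: interior_open algebra_simps)
  have Dneg: "D y \<le> 0" if "y > 0" for y
    using tangent[OF that, of "y + 1"] mono[OF that, of "y + 1"] that by simp
  have Dmono: "D y \<le> D z" if "0 < y" "y < z" for y z
  proof -
    \<comment> \<open>The sum of the tangent inequalities at the two points, in which the values of
      \<open>V\<close> cancel.\<close>
    have "D y * (z - y) + D z * (y - z) \<le> 0" using tangent[of y z] tangent[of z y] that by simp
    then have "(D y - D z) * (z - y) \<le> 0" by (simp add: algebra_simps)
    with that show ?thesis by (simp add: mult_le_0_iff)
  qed
  \<comment> \<open>The tangent at \<open>y\<close> is compared with \<open>V\<close> at
    \<open>y / 2\<close>, which is at most \<open>V 1\<close> once \<open>y \<ge> 2\<close>; this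
    forces the derivative to decay.\<close>
  have Dbound: "- D y \<le> 2 * V 1 / y" if "y \<ge> 2" for y
  proof -
    have "- D y * (y / 2) \<le> V (y / 2)" using tangent[of y "y / 2"] nonneg[of y] that by (simp add: field_simps)
    also have "\<dots> \<le> V 1" using mono[of 1 "y / 2"] that by simp
    finally show ?thesis using that by (simp add: field_simps)
  qed
  have D0: "((\<lambda>y. - D y) \<longlongrightarrow> 0) at_top"
  proof (rule tendsto_sandwich)
    show "\<forall>\<^sub>F y in at_top. 0 \<le> - D y" using eventually_gt_at_top[of 0] by eventually_elim (simp add: Dneg)
    show "\<forall>\<^sub>F y in at_top. - D y \<le> 2 * V 1 / y" using eventually_ge_at_top[of 2] by eventually_elim (rule Dbound)
    show "((\<lambda>y. 2 * V 1 / y) \<longlongrightarrow> 0) at_top"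
      by (intro tendsto_divide_0[OF tendsto_const] filterlim_at_top_imp_at_infinity filterlim_ident)
  qed simp
  have "((\<lambda>u. - D (exp u)) \<longlongrightarrow> 0) at_top" using filterlim_compose[OF D0 exp_at_top] by simp
  moreover have "continuous_on UNIV (\<lambda>u. - D (exp u))"
    by (intro continuous_intros continuous_on_compose2[OF D(2)]) auto
  moreover have "antimono (\<lambda>u. - D (exp u))"
  proof (rule antimonoI)
    fix u v :: real assume "u \<le> v"
    then show "- D (exp v) \<le> - D (exp u)" using Dmono[of "exp u" "exp v"] by (cases "u = v") auto
  qed
  moreover have "((\<lambda>u. - D (exp u) * exp ((1 - q) * u)) \<longlongrightarrow> 1) at_bot"
  proof -
    have "filterlim (exp :: real \<Rightarrow> real) (at_right 0) at_bot"
      unfolding filterlim_at using exp_at_bot by auto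
    from tendsto_minus[OF filterlim_compose[OF q this]]
    show ?thesis by (simp add: DV powr_def exp_minus[symmetric] divide_inverse algebra_simps)
  qed
  ultimately show ?thesis by (simp add: marginal_def DV Dneg)
qed

section \<open>Rates and integrals of the market model\<close>

context
  fixes r \<delta> \<theta> :: real
  assumes params: "r > 0" "\<delta> > 0" "\<theta> \<noteq> 0"
begin

interpretation market: discounted_heat "a_coeff \<theta>" "\<alpha>_coeff r \<delta> \<theta> - 1" "\<beta>_coeff r \<delta> \<theta>"
  by standard (use params in \<open>simp add: a_coeff_def\<close>)

lemma market_rate: "market.rate (1 - q) = lambda_rate r \<delta> \<theta> q"
  by (simp add: market.rate_def lambda_rate_def)

text \<open>Constants correspond to \<open>q = 1\<close>; positivity of \<open>r\<close> therefore
  makes the flow transient.\<close>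

lemma market_rate0: "market.rate 0 = - r"
  using market_rate[of 1] params by (simp add: lambda_rate_eq)

text \<open>The rate is a quadratic in \<open>q\<close> with roots \<open>\<alpha> - D\<close> and
  \<open>\<alpha> + D\<close>. It is negative at 1, so 1 lies strictly between them and only the
  lower root, \<open>q_star\<close>, is below 1.\<close>

lemma lambda_rate_factor:
  defines "D \<equiv> sqrt ((\<alpha>_coeff r \<delta> \<theta>)\<^sup>2 + 2 * \<delta> / \<theta>\<^sup>2)"
  shows "lambda_rate r \<delta> \<theta> q = \<theta>\<^sup>2 / 2 * ((\<alpha>_coeff r \<delta> \<theta> - q)\<^sup>2 - D\<^sup>2)"
    and "0 < D" and "q < 1 \<Longrightarrow> - D < \<alpha>_coeff r \<delta> \<theta> - q"
proof -
  have pos: "(\<alpha>_coeff r \<delta> \<theta>)\<^sup>2 + 2 * \<delta> / \<theta>\<^sup>2 > 0"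
    using params by (intro add_nonneg_pos) auto
  then show D: "0 < D" by (simp add: D_def)
  have D2: "D\<^sup>2 = (\<alpha>_coeff r \<delta> \<theta>)\<^sup>2 + 2 * \<delta> / \<theta>\<^sup>2" using pos by (simp add: D_def)
  show eq: "lambda_rate r \<delta> \<theta> q = \<theta>\<^sup>2 / 2 * ((\<alpha>_coeff r \<delta> \<theta> - q)\<^sup>2 - D\<^sup>2)" for q
    unfolding D2 lambda_rate_def \<beta>_coeff_def a_coeff_def using params by (simp add: power_divide field_simps)
  have "lambda_rate r \<delta> \<theta> 1 < 0" using params by (simp add: lambda_rate_eq)
  then have "(\<alpha>_coeff r \<delta> \<theta> - 1)\<^sup>2 < D\<^sup>2" using params unfolding eq by (auto simp: mult_less_0_iff)
  then have "\<bar>\<alpha>_coeff r \<delta> \<theta> - 1\<bar>\<^sup>2 < D\<^sup>2" by simp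
  then have "\<bar>\<alpha>_coeff r \<delta> \<theta> - 1\<bar> < D" using D by (rule power2_less_imp_less[OF _ less_imp_le])
  then show "- D < \<alpha>_coeff r \<delta> \<theta> - q" if "q < 1" using that by linarith
qed

lemma lambda_rate_neg:
  assumes "q_star r \<delta> \<theta> < q" "q < 1"
  shows "lambda_rate r \<delta> \<theta> q < 0"
proof -
  define D where "D = sqrt ((\<alpha>_coeff r \<delta> \<theta>)\<^sup>2 + 2 * \<delta> / \<theta>\<^sup>2)"
  have "\<bar>\<alpha>_coeff r \<delta> \<theta> - q\<bar> < D"
    using assms lambda_rate_factor(3)[OF assms(2)] by (simp add: q_star_def D_def abs_less_iff)
  then have "\<bar>\<alpha>_coeff r \<delta> \<theta> - q\<bar>\<^sup>2 < D\<^sup>2" by (intro power_strict_mono) auto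
  then show ?thesis
    using params unfolding lambda_rate_factor(1) D_def[symmetric] by (auto intro!: mult_pos_neg)
qed

lemma lambda_rate_q_star: "lambda_rate r \<delta> \<theta> (q_star r \<delta> \<theta>) = 0"
proof -
  have "c * ((A - (A - S))\<^sup>2 - S\<^sup>2) = 0" for c A S :: real by simp
  then show ?thesis unfolding lambda_rate_factor(1) q_star_def .
qed

text \<open>The logarithm turns the dilation of \<open>y\<close> into a translation, and the sign of
  the derivative resolves the absolute value.\<close>

lemma heat_integral_eq:
  assumes "y > 0" and g: "\<And>u. 0 \<le> - deriv V (exp u)"
  shows "heat_integral r \<delta> \<theta> V y t = market.heat t (\<lambda>u. - deriv V (exp u)) (ln y)"
proof -
  have "\<bar>deriv V (y * exp z)\<bar> = - deriv V (exp (ln y + z))" for z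
    using g[of "ln y + z"] assms(1) by (simp add: exp_add)
  then have "gauss_kernel (- ((\<alpha>_coeff r \<delta> \<theta> - 1) * (a_coeff \<theta> * sqrt t))) \<eta> *
      (- deriv V (exp (ln y + a_coeff \<theta> * sqrt t * \<eta>))) =
      exp (- (\<eta>\<^sup>2 / 4) - (\<alpha>_coeff r \<delta> \<theta> - 1) * a_coeff \<theta> * sqrt t * \<eta>) *
      \<bar>deriv V (y * exp (a_coeff \<theta> * sqrt t * \<eta>))\<bar>" for \<eta>
    by (simp add: gauss_kernel_def mult.assoc)
  then show ?thesis
    by (simp only: heat_integral_def market.heat_def)
qed

end

theorem theorem2p6:
  fixes r \<delta> \<mu> \<sigma> \<theta> q1 q2 :: real
    and U1 U2 V1 V2 :: "real \<Rightarrow> real"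
  assumes "r > 0" "\<delta> > 0" "\<mu> > 0" "\<sigma> > 0"
    and "\<theta> = (\<mu> - r) / \<sigma>" "\<theta> \<noteq> 0"
    and "utility_function U1" "utility_function U2"
    and "V1 = dual_function U1" "V2 = dual_function U2"
    and "q1 < 1" "q2 < 1" "q1 \<ge> q_star r \<delta> \<theta>" "q2 > q_star r \<delta> \<theta>"
    and "V1 C1_differentiable_on {0<..}" "V2 C1_differentiable_on {0<..}"
    and "((\<lambda>y. deriv V1 y / y powr (q1 - 1)) \<longlongrightarrow> -1) (at_right 0)"
    and "((\<lambda>y. deriv V2 y / y powr (q2 - 1)) \<longlongrightarrow> -1) (at_right 0)"
  shows "(\<forall>x>0.
            (\<exists>!Y. Y > 0 \<and>
               x = Y powr (q1 - 1) * of_bool (q1 = q_star r \<delta> \<theta>) + h_fun r \<delta> \<theta> V2 Y) \<and>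
            (\<forall>Y>0. x = Y powr (q1 - 1) * of_bool (q1 = q_star r \<delta> \<theta>) + h_fun r \<delta> \<theta> V2 Y \<longrightarrow>
               ((\<lambda>t. risky_amount r \<delta> \<sigma> \<theta> V1 V2 x t) \<longlongrightarrow>
                  \<theta> / \<sigma> * ((1 - q1) * Y powr (q1 - 1) * of_bool (q1 = q_star r \<delta> \<theta>)
                            - Y * deriv (h_fun r \<delta> \<theta> V2) Y)) at_top \<and>
               ((\<lambda>t. consumption_rate r \<delta> \<theta> V1 V2 x t) \<longlongrightarrow> - deriv V2 Y) at_top))
       \<and> ((\<forall>y>0. deriv V2 y = - (y powr (q2 - 1))) \<and> q2 < 0 \<and>
            q1 > q_star r \<delta> \<theta> \<and> q2 > q_star r \<delta> \<theta> \<longrightarrow>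
          (\<forall>x>0.
            ((\<lambda>t. risky_amount r \<delta> \<sigma> \<theta> V1 V2 x t) \<longlongrightarrow> \<theta> / \<sigma> * (1 - q2) * x) at_top \<and>
            ((\<lambda>t. consumption_rate r \<delta> \<theta> V1 V2 x t) \<longlongrightarrow> - lambda_rate r \<delta> \<theta> q2 * x) at_top))"
proof -
  note params = \<open>r > 0\<close> \<open>\<delta> > 0\<close> \<open>\<theta> \<noteq> 0\<close>
  define g1 where "g1 u = - deriv V1 (exp u)" for u
  define g2 where "g2 u = - deriv V2 (exp u)" for u
  have marg: "marginal (1 - q1) g1" "marginal (1 - q2) g2"
    unfolding g1_def[abs_def] g2_def[abs_def]
    by (rule marginal_dual_function; fact)+
  \<comment> \<open>The equivalence converts the indicator of a vanishing rate in
    \<open>limit_wealth\<close> into the indicator of \<open>q1 = q_star\<close> in the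
    claim.\<close>
  have rate1: "lambda_rate r \<delta> \<theta> q1 \<le> 0" "lambda_rate r \<delta> \<theta> q1 = 0 \<longleftrightarrow> q1 = q_star r \<delta> \<theta>"
    using lambda_rate_neg[OF params, of q1] lambda_rate_q_star[OF params] assms(11,13)
    by (cases "q1 = q_star r \<delta> \<theta>"; force)+
  have rate2: "lambda_rate r \<delta> \<theta> q2 < 0"
    by (rule lambda_rate_neg[OF params]) fact+
  interpret M: consumption_model "a_coeff \<theta>" "\<alpha>_coeff r \<delta> \<theta> - 1" "\<beta>_coeff r \<delta> \<theta>" "1 - q1" "1 - q2" g1 g2
  proof unfold_locales
    show "a_coeff \<theta> \<noteq> 0" using params by (simp add: a_coeff_def)
    show "discounted_heat.rate (a_coeff \<theta>) (\<alpha>_coeff r \<delta> \<theta> - 1) (\<beta>_coeff r \<delta> \<theta>) 0 < 0"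
      unfolding market_rate0[OF params] using params by simp
    show "discounted_heat.rate (a_coeff \<theta>) (\<alpha>_coeff r \<delta> \<theta> - 1) (\<beta>_coeff r \<delta> \<theta>) (1 - q1) \<le> 0"
      "discounted_heat.rate (a_coeff \<theta>) (\<alpha>_coeff r \<delta> \<theta> - 1) (\<beta>_coeff r \<delta> \<theta>) (1 - q2) < 0"
      unfolding market_rate[OF params] by (fact rate1(1) rate2)+
    show "marginal (1 - q1) g1" "marginal (1 - q2) g2" by (fact marg)+
    show "0 < 1 - q1" "0 < 1 - q2" using assms(11,12) by simp_all
  qed
  have rates: "M.rate (1 - q1) = lambda_rate r \<delta> \<theta> q1" "M.rate (1 - q2) = lambda_rate r \<delta> \<theta> q2"
    by (rule market_rate[OF params])+
  have nonneg: "0 \<le> g1 u" "0 \<le> g2 u" for u using marg by (auto simp: marginal_def)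
  have powr_exp: "y powr (q - 1) = exp (- ((1 - q) * ln y))" if "y > 0" for y q :: real
    using that by (simp add: powr_def algebra_simps)
  have I: "heat_integral r \<delta> \<theta> V1 y t = M.heat t g1 (ln y)" "heat_integral r \<delta> \<theta> V2 y t = M.heat t g2 (ln y)"
    if "y > 0" for y t
    using heat_integral_eq[OF params that, of V1] heat_integral_eq[OF params that, of V2] nonneg
    by (auto simp: g1_def[abs_def] g2_def[abs_def])
  have v_y: "v_y r \<delta> \<theta> V1 V2 y t = - M.wealth t (ln y)" if "y > 0" for y t
    using that by (simp add: v_y_def M.wealth_def I M.time_heat_def set_lebesgue_integral_def)
  have h: "h_fun r \<delta> \<theta> V2 y = M.time_heat {0<..} g2 (ln y)" if "y > 0" for y
  proof -
    have "gauss_kernel (- ((\<alpha>_coeff r \<delta> \<theta> - 1) * (a_coeff \<theta> * sqrt t))) \<eta> * g2 (ln y + a_coeff \<theta> * sqrt t * \<eta>) =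
        - (exp (- (\<eta>\<^sup>2 / 4) - (\<alpha>_coeff r \<delta> \<theta> - 1) * a_coeff \<theta> * sqrt t * \<eta>) *
        deriv V2 (y * exp (a_coeff \<theta> * sqrt t * \<eta>)))" for t \<eta>
      using that by (simp add: g2_def gauss_kernel_def exp_add mult.assoc)
    then show ?thesis
      by (simp add: h_fun_def M.time_heat_def M.heat_def set_lebesgue_integral_def)
  qed
  have limit: "y powr (q1 - 1) * of_bool (q1 = q_star r \<delta> \<theta>) + h_fun r \<delta> \<theta> V2 y = M.limit_wealth (ln y)"
    if "y > 0" for y
    using that by (simp add: h M.limit_wealth_def rates rate1 powr_exp)
  \<comment> \<open>The representation through \<open>ln\<close> holds only for positive arguments,
    so the derivative is transferred on the open half-line. Multiplying by \<open>y\<close> later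
    cancels the factor \<open>1 / y\<close>.\<close>
  have deriv_ln: "deriv f y = D / y"
    if "(F has_real_derivative D) (at (ln y))" "\<And>z. z > 0 \<Longrightarrow> f z = F (ln z)" "y > 0" for f F D y
  proof (rule DERIV_imp_deriv, rule has_field_derivative_transform_within_open[where S = "{0<..}"])
    show "((\<lambda>z. F (ln z)) has_real_derivative D / y) (at y)"
      using DERIV_chain2[OF that(1) DERIV_ln[OF that(3)]] by (simp add: divide_inverse)
  qed (use that in auto)
  have v_yy: "y * v_yy r \<delta> \<theta> V1 V2 y t = - M.wealth_deriv t (ln y)" if "y > 0" "t > 0" for y t
    unfolding v_yy_def
    using deriv_ln[OF DERIV_minus[OF M.has_real_derivative_wealth[OF that(2)]] v_y that(1)] that by simp
  have dh: "y * deriv (h_fun r \<delta> \<theta> V2) y = M.time_heat_deriv {0<..} g2 (ln y)" if "y > 0" for y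
    using deriv_ln[OF M.has_real_derivative_accumulated h that] that by simp
  have main: "((\<lambda>t. risky_amount r \<delta> \<sigma> \<theta> V1 V2 x t) \<longlongrightarrow>
         \<theta> / \<sigma> * ((1 - q1) * Y powr (q1 - 1) * of_bool (q1 = q_star r \<delta> \<theta>) - Y * deriv (h_fun r \<delta> \<theta> V2) Y)) at_top"
    "((\<lambda>t. consumption_rate r \<delta> \<theta> V1 V2 x t) \<longlongrightarrow> - deriv V2 Y) at_top"
    if Y: "Y > 0" "x = Y powr (q1 - 1) * of_bool (q1 = q_star r \<delta> \<theta>) + h_fun r \<delta> \<theta> V2 Y" for x Y
  proof -
    let ?y = "\<lambda>t. dual_point r \<delta> \<theta> V1 V2 x t"
    have x: "x = M.limit_wealth (ln Y)" using Y limit by simp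
    \<comment> \<open>Strict monotonicity makes any root unique, which evaluates the definite
      description in \<open>dual_point\<close> as soon as a root is known.\<close>
    have point: "?y t = exp s" if "t > 0" "M.wealth t s = x" for t s
      unfolding dual_point_def
    proof (rule the_equality)
      show "exp s > 0 \<and> x = - v_y r \<delta> \<theta> V1 V2 (exp s) t" using that by (simp add: v_y)
      fix y assume y: "y > 0 \<and> x = - v_y r \<delta> \<theta> V1 V2 y t"
      then have "M.wealth t (ln y) = M.wealth t s" using that by (simp add: v_y)
      then have "ln y = s"
        using M.wealth_strict_antimono[OF that(1), of "ln y" s] M.wealth_strict_antimono[OF that(1), of s "ln y"]
        by (cases "ln y" s rule: linorder_cases) auto
      with y show "y = exp s" by auto
    qed
    \<comment> \<open>Roots are provided for large \<open>t\<close>, which is enough for limits and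
      also shows that the dual point is eventually positive.\<close>
    have near: "\<forall>\<^sub>F t in at_top. t > 0 \<and> ?y t > 0 \<and> \<bar>ln (?y t) - ln Y\<bar> < e" if "e > 0" for e
      using M.eventually_wealth_root[OF that, of "ln Y"] unfolding x[symmetric]
    proof eventually_elim
      case (elim t)
      then obtain s where "t > 0" "\<bar>s - ln Y\<bar> < e" "M.wealth t s = x" by blast
      with point[of t s] show ?case by simp
    qed
    have lim: "((\<lambda>t. ln (?y t)) \<longlongrightarrow> ln Y) at_top"
    proof (rule tendstoI)
      fix e :: real assume "e > 0"
      from near[OF this] show "\<forall>\<^sub>F t in at_top. dist (ln (?y t)) (ln Y) < e"
        by eventually_elim (simp add: dist_real_def)
    qed
    note pos = near[OF zero_less_one]
    \<comment> \<open>The derivative converges along the moving point \<open>ln (?y t)\<close>;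
      convergence at a fixed point would not suffice.\<close>
    have "((\<lambda>t. \<theta> / \<sigma> * (- M.wealth_deriv t (ln (?y t)))) \<longlongrightarrow> \<theta> / \<sigma> * (- M.limit_wealth_deriv (ln Y))) at_top"
      by (intro tendsto_intros M.wealth_deriv_tendsto lim)
    moreover have "\<forall>\<^sub>F t in at_top. \<theta> / \<sigma> * (- M.wealth_deriv t (ln (?y t))) = risky_amount r \<delta> \<sigma> \<theta> V1 V2 x t"
      using pos by eventually_elim (simp add: risky_amount_def Let_def v_yy mult.assoc del: mult_minus_right)
    ultimately have "((\<lambda>t. risky_amount r \<delta> \<sigma> \<theta> V1 V2 x t) \<longlongrightarrow> \<theta> / \<sigma> * (- M.limit_wealth_deriv (ln Y))) at_top"
      by (rule Lim_transform_eventually)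
    also have "- M.limit_wealth_deriv (ln Y) =
        (1 - q1) * Y powr (q1 - 1) * of_bool (q1 = q_star r \<delta> \<theta>) - Y * deriv (h_fun r \<delta> \<theta> V2) Y"
      using Y(1) by (simp add: M.limit_wealth_deriv_def dh rates rate1 powr_exp algebra_simps)
    finally show "((\<lambda>t. risky_amount r \<delta> \<sigma> \<theta> V1 V2 x t) \<longlongrightarrow>
         \<theta> / \<sigma> * ((1 - q1) * Y powr (q1 - 1) * of_bool (q1 = q_star r \<delta> \<theta>) - Y * deriv (h_fun r \<delta> \<theta> V2) Y)) at_top" .
    have "continuous_on UNIV g2" using marg by (simp add: marginal_def)
    then have "((\<lambda>t. g2 (ln (?y t))) \<longlongrightarrow> g2 (ln Y)) at_top"
      using lim by (rule continuous_on_tendsto_compose) auto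
    moreover have "\<forall>\<^sub>F t in at_top. g2 (ln (?y t)) = consumption_rate r \<delta> \<theta> V1 V2 x t"
      using pos by eventually_elim (auto simp: consumption_rate_def g2_def)
    ultimately have "((\<lambda>t. consumption_rate r \<delta> \<theta> V1 V2 x t) \<longlongrightarrow> g2 (ln Y)) at_top"
      by (rule Lim_transform_eventually)
    then show "((\<lambda>t. consumption_rate r \<delta> \<theta> V1 V2 x t) \<longlongrightarrow> - deriv V2 Y) at_top"
      using Y(1) by (simp add: g2_def)
  qed
  have ex1: "\<exists>!Y. Y > 0 \<and> x = Y powr (q1 - 1) * of_bool (q1 = q_star r \<delta> \<theta>) + h_fun r \<delta> \<theta> V2 Y" if x: "x > 0" for x
  proof -
    obtain s where s: "M.limit_wealth s = x" using M.limit_wealth_surj[OF x] by auto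
    show ?thesis
    proof (rule ex1I[of _ "exp s"])
      show "exp s > 0 \<and> x = exp s powr (q1 - 1) * of_bool (q1 = q_star r \<delta> \<theta>) + h_fun r \<delta> \<theta> V2 (exp s)"
        using limit[of "exp s"] s by simp
      fix y assume y: "y > 0 \<and> x = y powr (q1 - 1) * of_bool (q1 = q_star r \<delta> \<theta>) + h_fun r \<delta> \<theta> V2 y"
      then have "M.limit_wealth (ln y) = M.limit_wealth s" using limit s by simp
      then have "ln y = s"
        using M.limit_wealth_strict_antimono[of "ln y" s] M.limit_wealth_strict_antimono[of s "ln y"]
        by (cases "ln y" s rule: linorder_cases) auto
      with y show "y = exp s" by auto
    qed
  qed
  have power: "((\<lambda>t. risky_amount r \<delta> \<sigma> \<theta> V1 V2 x t) \<longlongrightarrow> \<theta> / \<sigma> * (1 - q2) * x) at_top \<and>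
      ((\<lambda>t. consumption_rate r \<delta> \<theta> V1 V2 x t) \<longlongrightarrow> - lambda_rate r \<delta> \<theta> q2 * x) at_top"
    if V2: "\<forall>y>0. deriv V2 y = - (y powr (q2 - 1))" and q1: "q1 > q_star r \<delta> \<theta>" and x: "x > 0" for x
  proof -
    obtain Y where Y: "Y > 0" "x = Y powr (q1 - 1) * of_bool (q1 = q_star r \<delta> \<theta>) + h_fun r \<delta> \<theta> V2 Y"
      using ex1[OF x] by auto
    have g2: "g2 = (\<lambda>u. exp (- ((1 - q2) * u)))"
      using V2 by (auto simp: g2_def powr_exp)
    \<comment> \<open>For a power utility \<open>g2\<close> is a single exponential, hence an
      eigenfunction of the flow, and its time integral is explicit.\<close>
    have hY: "M.time_heat {0<..} g2 = (\<lambda>s. exp (- ((1 - q2) * s)) / (- lambda_rate r \<delta> \<theta> q2))"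
      unfolding g2 rates(2)[symmetric] using rate2 by (intro ext M.time_heat_exp) (simp add: rates)
    have "M.time_heat_deriv {0<..} g2 (ln Y) = - (1 - q2) * (exp (- ((1 - q2) * ln Y)) / (- lambda_rate r \<delta> \<theta> q2))"
    proof (rule DERIV_unique[OF M.has_real_derivative_accumulated])
      show "(M.time_heat {0<..} g2 has_real_derivative
          - (1 - q2) * (exp (- ((1 - q2) * ln Y)) / (- lambda_rate r \<delta> \<theta> q2))) (at (ln Y))"
        unfolding hY using rate2 by (auto intro!: derivative_eq_intros simp: field_simps)
    qed auto
    \<comment> \<open>Since \<open>q1 > q_star\<close>, the power term of the equation for
      \<open>Y\<close> disappears and \<open>x\<close> is the value of \<open>h_fun\<close> at
      \<open>Y\<close>.\<close>
    moreover have xY: "x = exp (- ((1 - q2) * ln Y)) / (- lambda_rate r \<delta> \<theta> q2)"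
      using Y q1 h[OF Y(1)] hY by simp
    ultimately have dY: "Y * deriv (h_fun r \<delta> \<theta> V2) Y = - (1 - q2) * x"
      unfolding dh[OF Y(1)] by simp
    have "(1 - q1) * Y powr (q1 - 1) * of_bool (q1 = q_star r \<delta> \<theta>) - Y * deriv (h_fun r \<delta> \<theta> V2) Y = (1 - q2) * x"
      unfolding dY using q1 by (simp add: algebra_simps)
    then have 1: "\<theta> / \<sigma> * ((1 - q1) * Y powr (q1 - 1) * of_bool (q1 = q_star r \<delta> \<theta>) - Y * deriv (h_fun r \<delta> \<theta> V2) Y) =
        \<theta> / \<sigma> * (1 - q2) * x"
      by (simp only: mult.assoc)
    have 2: "- deriv V2 Y = - lambda_rate r \<delta> \<theta> q2 * x"
      using V2 Y(1) rate2 unfolding xY by (simp add: powr_exp)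
    show ?thesis using main[OF Y] unfolding 1 2 by simp
  qed
  show ?thesis
  proof (intro conjI allI impI)
    fix x :: real assume x: "x > 0"
    show "\<exists>!Y. Y > 0 \<and> x = Y powr (q1 - 1) * of_bool (q1 = q_star r \<delta> \<theta>) + h_fun r \<delta> \<theta> V2 Y"
      by (rule ex1[OF x])
  next
    fix x Y :: real
    assume "Y > 0" "x = Y powr (q1 - 1) * of_bool (q1 = q_star r \<delta> \<theta>) + h_fun r \<delta> \<theta> V2 Y"
    note main[OF this]
    then show "((\<lambda>t. risky_amount r \<delta> \<sigma> \<theta> V1 V2 x t) \<longlongrightarrow>
        \<theta> / \<sigma> * ((1 - q1) * Y powr (q1 - 1) * of_bool (q1 = q_star r \<delta> \<theta>) - Y * deriv (h_fun r \<delta> \<theta> V2) Y)) at_top"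
      and "((\<lambda>t. consumption_rate r \<delta> \<theta> V1 V2 x t) \<longlongrightarrow> - deriv V2 Y) at_top" .
  next
    fix x :: real
    assume V2: "(\<forall>y>0. deriv V2 y = - (y powr (q2 - 1))) \<and> q2 < 0 \<and> q1 > q_star r \<delta> \<theta> \<and> q2 > q_star r \<delta> \<theta>"
      and x: "x > 0"
    then have "\<forall>y>0. deriv V2 y = - (y powr (q2 - 1))" "q1 > q_star r \<delta> \<theta>" by auto
    note power[OF this x]
    then show "((\<lambda>t. risky_amount r \<delta> \<sigma> \<theta> V1 V2 x t) \<longlongrightarrow> \<theta> / \<sigma> * (1 - q2) * x) at_top"
      and "((\<lambda>t. consumption_rate r \<delta> \<theta> V1 V2 x t) \<longlongrightarrow> - lambda_rate r \<delta> \<theta> q2 * x) at_top"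
      by (rule conjunct1, rule conjunct2)
  qed
qed

end
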